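(* Let $L\ge 1$, $N=2L$, and consider the antiperiodic alternating $\mathfrak{gl}(1|1)$ spin chain on $\mathcal H_N=(\mathbb C^2)^{\otimes N}$ with operators $e_1,\dots,e_{2L}$ as described in the context. Then the algebra $\pi_{\mathfrak{gl}}(JTL^{tw}_N)$ is isomorphic (as an associative algebra) to the image of a representation of the universal enveloping algebra $U\mathfrak{sp}_{2L}$ in which every simple $\mathfrak{sp}_{2L}$-module that occurs corresponds to a one-column Young diagram (i.e. is a fundamental representation of $\mathfrak{sp}_{2L}$ or the trivial one).
   Context: On $\mathcal H_N=(\mathbb C^2)^{\otimes N}$, $N=2L$, there are operators $f_j,f_j^\dagger$ ($1\le j\le N$) (free-fermion realisation of the alternating $\mathfrak{gl}(1|1)$ chain, fundamental representation on even sites and its dual on odd sites) satisfying $\{f_j,f_{j'}\}=\{f_j^\dagger,f_{j'}^\dagger\}=0$ and $\{f_j,f_{j'}^\dagger\}=(-1)^j\delta_{jj'}$, and generating all of $\mathrm{End}(\mathcal H_N)$. In the antiperiodic chain one sets $f^{(\dagger)}_{N+1}=-f^{(\dagger)}_1$ and defines $e_j=(f_j+f_{j+1})(f_j^\dagger+f_{j+1}^\dagger)$ for $1\le j\le 2L-1$ and $e_{2L}=(f_{2L}-f_1)(f_{2L}^\dagger-f_1^\dagger)$. Let $u^2$ be the operator of translation by two sites compatible with these boundary conditions ($u^2 e_j u^{-2}=e_{j+2}$, indices mod $N$). These operators give a representation $\pi_{\mathfrak{gl}}$ of the twisted Jones–Temperley–Lieb algebra $JTL^{tw}_N$, and $\pi_{\mathfrak{gl}}(JTL^{tw}_N)$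 denotes the unital associative subalgebra of $\mathrm{End}(\mathcal H_N)$ generated by $e_1,\dots,e_{2L}$ and $u^{\pm2}$. *)

theory Defs
  imports "Jordan_Normal_Form.Matrix"
begin

(* Conventions: matrices are complex matrices of the Jordan_Normal_Form library,
   indices of matrix entries are 0-based; fermion site labels are 1..2L. *)

definition dimH :: "nat \<Rightarrow> nat" where
  "dimH L = 2 ^ (2 * L)"

inductive_set gen_alg :: "nat \<Rightarrow> complex mat set \<Rightarrow> complex mat set"
  for n :: nat and S :: "complex mat set" where
  one:   "1\<^sub>m n \<in> gen_alg n S"
| gen:   "x \<in> S \<Longrightarrow> x \<in> gen_alg n S"
| add:   "x \<in> gen_alg n S \<Longrightarrow> y \<in> gen_alg n S \<Longrightarrow> x + y \<in> gen_alg n S"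
| smult: "x \<in> gen_alg n S \<Longrightarrow> c \<cdot>\<^sub>m x \<in> gen_alg n S"
| mult:  "x \<in> gen_alg n S \<Longrightarrow> y \<in> gen_alg n S \<Longrightarrow> x * y \<in> gen_alg n S"

definition alg_iso :: "nat \<Rightarrow> nat \<Rightarrow> complex mat set \<Rightarrow> complex mat set \<Rightarrow> bool" where
  "alg_iso n m A B \<longleftrightarrow> (\<exists>\<phi>. bij_betw \<phi> A B \<and> \<phi> (1\<^sub>m n) = 1\<^sub>m m \<and>
      (\<forall>x\<in>A. \<forall>y\<in>A. \<phi> (x + y) = \<phi> x + \<phi> y \<and> \<phi> (x * y) = \<phi> x * \<phi> y) \<and>
      (\<forall>x\<in>A. \<forall>c. \<phi> (c \<cdot>\<^sub>m x) = c \<cdot>\<^sub>m \<phi> x))"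

definition anticomm :: "complex mat \<Rightarrow> complex mat \<Rightarrow> complex mat" where
  "anticomm A B = A * B + B * A"

definition fermions :: "nat \<Rightarrow> (nat \<Rightarrow> complex mat) \<Rightarrow> (nat \<Rightarrow> complex mat) \<Rightarrow> bool" where
  "fermions L f fd \<longleftrightarrow>
     (\<forall>j\<in>{1..2*L}. f j \<in> carrier_mat (dimH L) (dimH L) \<and> fd j \<in> carrier_mat (dimH L) (dimH L)) \<and>
     (\<forall>i\<in>{1..2*L}. \<forall>j\<in>{1..2*L}.
        anticomm (f i) (f j) = 0\<^sub>m (dimH L) (dimH L) \<and>
        anticomm (fd i) (fd j) = 0\<^sub>m (dimH L) (dimH L) \<and>
        anticomm (f i) (fd j) = (if i = j then (-1) ^ i else 0) \<cdot>\<^sub>m 1\<^sub>m (dimH L)) \<and>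
     gen_alg (dimH L) (f ` {1..2*L} \<union> fd ` {1..2*L}) = carrier_mat (dimH L) (dimH L)"

text \<open>Translation by two sites u^2 (with inverse u2i = u^{-2}), compatible with the
  antiperiodic condition f_{N+1} = -f_1 (hence f_{N+2} = -f_2):
  u^2 f_j u^{-2} = f_{j+2}, indices taken with the antiperiodic twist.\<close>
definition translation2 :: "nat \<Rightarrow> (nat \<Rightarrow> complex mat) \<Rightarrow> (nat \<Rightarrow> complex mat)
    \<Rightarrow> complex mat \<Rightarrow> complex mat \<Rightarrow> bool" where
  "translation2 L f fd u2 u2i \<longleftrightarrow>
     u2 \<in> carrier_mat (dimH L) (dimH L) \<and> u2i \<in> carrier_mat (dimH L) (dimH L) \<and>
     u2 * u2i = 1\<^sub>m (dimH L) \<and> u2i * u2 = 1\<^sub>m (dimH L) \<and>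
     (\<forall>j\<in>{1..2*L}.
        u2 * f j * u2i = (if j + 2 \<le> 2*L then f (j+2) else - f (j + 2 - 2*L)) \<and>
        u2 * fd j * u2i = (if j + 2 \<le> 2*L then fd (j+2) else - fd (j + 2 - 2*L)))"

definition jtl_e :: "nat \<Rightarrow> (nat \<Rightarrow> complex mat) \<Rightarrow> (nat \<Rightarrow> complex mat) \<Rightarrow> nat \<Rightarrow> complex mat" where
  "jtl_e L f fd j = (if j < 2*L then (f j + f (j+1)) * (fd j + fd (j+1))
                     else (f (2*L) - f 1) * (fd (2*L) - fd 1))"

definition jtl_image :: "nat \<Rightarrow> (nat \<Rightarrow> complex mat) \<Rightarrow> (nat \<Rightarrow> complex mat)
    \<Rightarrow> complex mat \<Rightarrow> complex mat \<Rightarrow> complex mat set" where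
  "jtl_image L f fd u2 u2i = gen_alg (dimH L) (jtl_e L f fd ` {1..2*L} \<union> {u2, u2i})"

definition sympJ :: "nat \<Rightarrow> complex mat" where
  "sympJ L = mat (2*L) (2*L) (\<lambda>(i,j). if j = i + L then 1 else if i = j + L then -1 else 0)"

definition sp_alg :: "nat \<Rightarrow> complex mat set" where
  "sp_alg L = {X \<in> carrier_mat (2*L) (2*L).
      transpose_mat X * sympJ L + sympJ L * X = 0\<^sub>m (2*L) (2*L)}"

definition lie_bracket :: "complex mat \<Rightarrow> complex mat \<Rightarrow> complex mat" where
  "lie_bracket A B = A * B - B * A"

text \<open>Cartan subalgebra: diagonal elements of sp_{2L}, i.e. diag(a_1..a_L, -a_1..-a_L).\<close>
definition sp_cartan :: "nat \<Rightarrow> complex mat set" where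
  "sp_cartan L = {H \<in> sp_alg L. \<forall>i<2*L. \<forall>j<2*L. i \<noteq> j \<longrightarrow> H $$ (i,j) = 0}"

text \<open>Positive nilpotent part n_+: elements [[A, B],[0, -A^T]] of sp_{2L} with A strictly
  upper triangular (positive roots e_i - e_j (i<j), e_i + e_j, 2 e_i).\<close>
definition sp_nplus :: "nat \<Rightarrow> complex mat set" where
  "sp_nplus L = {X \<in> sp_alg L.
      (\<forall>i<2*L. \<forall>j<L. L \<le> i \<longrightarrow> X $$ (i,j) = 0) \<and>
      (\<forall>i<L. \<forall>j<L. j \<le> i \<longrightarrow> X $$ (i,j) = 0)}"

text \<open>Finite-dimensional representation of sp_{2L} on C^n (= Lie algebra homomorphism
  sp_{2L} -> gl_n; it extends uniquely to U(sp_{2L})).\<close>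
definition sp_rep :: "nat \<Rightarrow> nat \<Rightarrow> (complex mat \<Rightarrow> complex mat) \<Rightarrow> bool" where
  "sp_rep L n \<rho> \<longleftrightarrow>
     (\<forall>X\<in>sp_alg L. \<rho> X \<in> carrier_mat n n) \<and>
     (\<forall>X\<in>sp_alg L. \<forall>Y\<in>sp_alg L. \<forall>a b. \<rho> (a \<cdot>\<^sub>m X + b \<cdot>\<^sub>m Y) = a \<cdot>\<^sub>m \<rho> X + b \<cdot>\<^sub>m \<rho> Y) \<and>
     (\<forall>X\<in>sp_alg L. \<forall>Y\<in>sp_alg L. \<rho> (lie_bracket X Y) = lie_bracket (\<rho> X) (\<rho> Y))"

definition lin_subspace :: "nat \<Rightarrow> complex vec set \<Rightarrow> bool" where
  "lin_subspace n W \<longleftrightarrow> W \<subseteq> carrier_vec n \<and> 0\<^sub>v n \<in> W \<and>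
     (\<forall>v\<in>W. \<forall>w\<in>W. v + w \<in> W) \<and> (\<forall>v\<in>W. \<forall>c. c \<cdot>\<^sub>v v \<in> W)"

definition invariant_sub :: "nat \<Rightarrow> nat \<Rightarrow> (complex mat \<Rightarrow> complex mat) \<Rightarrow> complex vec set \<Rightarrow> bool" where
  "invariant_sub L n \<rho> W \<longleftrightarrow> lin_subspace n W \<and> (\<forall>X\<in>sp_alg L. \<forall>w\<in>W. \<rho> X *\<^sub>v w \<in> W)"

definition simple_sub :: "nat \<Rightarrow> nat \<Rightarrow> (complex mat \<Rightarrow> complex mat) \<Rightarrow> complex vec set \<Rightarrow> bool" where
  "simple_sub L n \<rho> W \<longleftrightarrow> invariant_sub L n \<rho> W \<and> W \<noteq> {0\<^sub>v n} \<and>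
     (\<forall>U. invariant_sub L n \<rho> U \<and> U \<subseteq> W \<longrightarrow> U = {0\<^sub>v n} \<or> U = W)"

text \<open>A simple module W has highest weight omega_k = e_1 + ... + e_k (one-column Young
  diagram with k boxes; k = 0 is the trivial module), i.e. W is the k-th fundamental
  representation of sp_{2L} (or the trivial one for k = 0).\<close>
definition has_hw_omega :: "nat \<Rightarrow> nat \<Rightarrow> (complex mat \<Rightarrow> complex mat) \<Rightarrow> complex vec set \<Rightarrow> nat \<Rightarrow> bool" where
  "has_hw_omega L n \<rho> W k \<longleftrightarrow> (\<exists>v\<in>W. v \<noteq> 0\<^sub>v n \<and>
      (\<forall>X\<in>sp_nplus L. \<rho> X *\<^sub>v v = 0\<^sub>v n) \<and>
      (\<forall>H\<in>sp_cartan L. \<rho> H *\<^sub>v v = (\<Sum>i<k. H $$ (i,i)) \<cdot>\<^sub>v v))"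

definition one_column_rep :: "nat \<Rightarrow> nat \<Rightarrow> (complex mat \<Rightarrow> complex mat) \<Rightarrow> bool" where
  "one_column_rep L n \<rho> \<longleftrightarrow>
     (\<forall>W. simple_sub L n \<rho> W \<longrightarrow> (\<exists>k\<le>L. has_hw_omega L n \<rho> W k))"

definition Usp_image :: "nat \<Rightarrow> nat \<Rightarrow> (complex mat \<Rightarrow> complex mat) \<Rightarrow> complex mat set" where
  "Usp_image L n \<rho> = gen_alg n (\<rho> ` sp_alg L)"

end

theory Submission
  imports Defs "Jordan_Normal_Form.Determinant"
begin

text \<open>With \<open>a j = f j + f (j + 1)\<close> (antiperiodically) and \<open>b j = (-1) ^ j\<close> times the analogous sum of
  the \<open>fd\<close>, the anticommutators \<open>{a j, b k}\<close> form a nondegenerate antisymmetric matrix. Thus the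
  \<open>a j\<close> span a symplectic space \<open>V\<close> of dimension \<open>2 L\<close>, \<open>H\<close> is the exterior algebra of \<open>V\<close>, and
  \<open>a j * b j\<close>, which is \<open>e j\<close> up to sign, represents the square of \<open>a j\<close> in \<open>Sym\<^sup>2 V = sp(V)\<close>. Commutators
  of these squares yield all products \<open>a j * b k + a k * b j\<close>, hence the image of \<open>sp(V)\<close>. Fourier
  modes diagonalise the translation and provide a symplectic basis of \<open>V\<close>; up to a scalar,
  the translation is a product of quadratic polynomials in the Cartan generators and so belongs to the image
  of the enveloping algebra. A highest weight of a submodule of the exterior algebra has entries in
  \<open>{-1, 0, 1}\<close> and is dominant, so it is \<open>\<epsilon>\<^sub>1 + \<dots> + \<epsilon>\<^sub>k\<close>.\<close>

subsection \<open>Matrices inside a single ring\<close>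

text \<open>Matrix identities hold only relative to a carrier of fixed size. The algebra is
  therefore done in an abstract complex algebra, where ring rewriting has no side conditions, and
  carried over along an injective unital embedding.

  The isomorphism is the identity map: the representation acts on the chain itself, and two
  inclusions show that both families of generators generate the same set of matrices. Each
  \<open>e j\<close> is a scalar times a quadratic element of sp, and conversely the
  \<open>e j\<close> alone already yield all of sp. The translation is not a polynomial in sp by
  inspection. Instead, the Cartan elements produce an invertible \<open>D\<close> that conjugates
  every Fourier mode exactly as the translation does; the quotient commutes with all fermions, which
  generate the full matrix algebra, and so is a scalar.

  Antiperiodicity enters through the momenta: the solutions of \<open>z ^ (2*L) = -1\<close> avoid 1
  and -1, the two values at which the form on the modes would vanish.\<close>

locale calg = vector_space scale
  for scale :: "complex \<Rightarrow> 'a::ring_1 \<Rightarrow> 'a" (infixr "*s" 75) +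
  assumes scale_mult_left: "(c *s x) * y = c *s (x * y)"
    and scale_mult_right: "x * (c *s y) = c *s (x * y)"
begin

definition subalg :: "'a set \<Rightarrow> bool" where
  "subalg A \<longleftrightarrow> 1 \<in> A \<and> (\<forall>x\<in>A. \<forall>y\<in>A. x + y \<in> A \<and> x * y \<in> A) \<and> (\<forall>x\<in>A. \<forall>c. c *s x \<in> A)"

lemma subalg_one: "subalg A \<Longrightarrow> 1 \<in> A"
  and subalg_add: "subalg A \<Longrightarrow> x \<in> A \<Longrightarrow> y \<in> A \<Longrightarrow> x + y \<in> A"
  and subalg_mult: "subalg A \<Longrightarrow> x \<in> A \<Longrightarrow> y \<in> A \<Longrightarrow> x * y \<in> A"
  and subalg_scale: "subalg A \<Longrightarrow> x \<in> A \<Longrightarrow> c *s x \<in> A"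
  by (auto simp: subalg_def)

lemma subalg_zero: "subalg A \<Longrightarrow> 0 \<in> A"
  using subalg_scale[OF _ subalg_one, of A 0] by simp

lemma subalg_uminus: "subalg A \<Longrightarrow> x \<in> A \<Longrightarrow> - x \<in> A"
  using subalg_scale[of A x "-1"] by simp

lemma subalg_diff: "subalg A \<Longrightarrow> x \<in> A \<Longrightarrow> y \<in> A \<Longrightarrow> x - y \<in> A"
  using subalg_add[of A x "- y"] subalg_uminus[of A y] by simp

lemma subalg_sum: "subalg A \<Longrightarrow> (\<And>i. i \<in> I \<Longrightarrow> x i \<in> A) \<Longrightarrow> sum x I \<in> A"
  by (induction I rule: infinite_finite_induct) (auto intro: subalg_zero subalg_add)

lemma scale_cancel_subalg: "subalg A \<Longrightarrow> c *s x \<in> A \<Longrightarrow> c \<noteq> 0 \<Longrightarrow> x \<in> A"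
  using subalg_scale[of A "c *s x" "1 / c"] by simp

lemma double_eq_zero:
  fixes x :: 'a
  assumes "x = - x" shows "x = 0"
proof -
  have "x + x = 0" using assms by (metis add.right_inverse)
  then have "2 *s x = 0" using scale_left_distrib[of 1 1 x] by simp
  then show ?thesis by simp
qed

lemma mult_sum_scale:
  "(\<Sum>i\<in>I. s i *s x i) * (\<Sum>k\<in>K. t k *s y k) = (\<Sum>i\<in>I. \<Sum>k\<in>K. (s i * t k) *s (x i * y k))"
  by (simp add: sum_product scale_mult_left scale_mult_right mult.commute[of "t _"])

end

text \<open>Linear maps of an infinite-dimensional space: one type serves for all matrix sizes
  \<open>2 ^ (2 * L)\<close>. The single equation encodes additivity (\<open>c = 1\<close>) and,
  once the image of zero is known to vanish, homogeneity.\<close>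

typedef cendo = "{F :: (nat \<Rightarrow> complex) \<Rightarrow> nat \<Rightarrow> complex.
    \<forall>u v c. F (\<lambda>i. u i + c * v i) = (\<lambda>i. F u i + c * F v i)}"
  by (rule exI[of _ "\<lambda>u. u"]) simp

lemma Rep_cendo_linear: "Rep_cendo F (\<lambda>i. u i + c * v i) = (\<lambda>i. Rep_cendo F u i + c * Rep_cendo F v i)"
  using Rep_cendo[of F] by blast

lemma Rep_cendo_add: "Rep_cendo F (\<lambda>i. u i + v i) = (\<lambda>i. Rep_cendo F u i + Rep_cendo F v i)"
  using Rep_cendo_linear[of F u 1 v] by simp

lemma Rep_cendo_zero: "Rep_cendo F (\<lambda>i. 0) = (\<lambda>i. 0)"
  using Rep_cendo_linear[of F "\<lambda>i. 0" "-1" "\<lambda>i. 0"] by simp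

lemma Rep_cendo_scale: "Rep_cendo F (\<lambda>i. c * v i) = (\<lambda>i. c * Rep_cendo F v i)"
  using Rep_cendo_linear[of F "\<lambda>i. 0" c v] Rep_cendo_zero[of F] by simp

instantiation cendo :: ring_1
begin

definition "0 = Abs_cendo (\<lambda>u i. 0)"
definition "1 = Abs_cendo (\<lambda>u. u)"
definition "F + G = Abs_cendo (\<lambda>u i. Rep_cendo F u i + Rep_cendo G u i)"
definition "F - G = Abs_cendo (\<lambda>u i. Rep_cendo F u i - Rep_cendo G u i)"
definition "- F = Abs_cendo (\<lambda>u i. - Rep_cendo F u i)"
definition "F * G = Abs_cendo (\<lambda>u. Rep_cendo F (Rep_cendo G u))"

lemma Rep_cendo_ops:
  "Rep_cendo 0 = (\<lambda>u i. 0)"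
  "Rep_cendo 1 = (\<lambda>u. u)"
  "Rep_cendo (F + G) = (\<lambda>u i. Rep_cendo F u i + Rep_cendo G u i)"
  "Rep_cendo (F - G) = (\<lambda>u i. Rep_cendo F u i - Rep_cendo G u i)"
  "Rep_cendo (- F) = (\<lambda>u i. - Rep_cendo F u i)"
  "Rep_cendo (F * G) = (\<lambda>u. Rep_cendo F (Rep_cendo G u))"
  unfolding zero_cendo_def one_cendo_def plus_cendo_def minus_cendo_def uminus_cendo_def times_cendo_def
  by (subst Abs_cendo_inverse; simp add: Rep_cendo_linear algebra_simps)+

instance
proof
  have "Rep_cendo 0 \<noteq> Rep_cendo 1"
    by (auto simp: Rep_cendo_ops fun_eq_iff intro!: exI[of _ "\<lambda>_. 1"])
  then show "(0::cendo) \<noteq> 1" by metis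
qed (simp_all add: Rep_cendo_inject[symmetric] Rep_cendo_ops Rep_cendo_add algebra_simps)

end

definition cendo_scale :: "complex \<Rightarrow> cendo \<Rightarrow> cendo" where
  "cendo_scale c F = Abs_cendo (\<lambda>u i. c * Rep_cendo F u i)"

lemma Rep_cendo_scale_cendo: "Rep_cendo (cendo_scale c F) = (\<lambda>u i. c * Rep_cendo F u i)"
  unfolding cendo_scale_def by (subst Abs_cendo_inverse; simp add: Rep_cendo_linear algebra_simps)

interpretation cendo: calg cendo_scale
  by unfold_locales
    (simp_all add: Rep_cendo_inject[symmetric] Rep_cendo_ops Rep_cendo_scale_cendo Rep_cendo_scale
      algebra_simps)

text \<open>Square matrices of every size embed unitally into the one ring \<open>cendo\<close>: a vector in
  \<open>nat \<Rightarrow> complex\<close> is cut into consecutive blocks of length \<open>n\<close>, and the matrix acts on each block.\<close>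

definition emb :: "nat \<Rightarrow> complex mat \<Rightarrow> cendo" where
  "emb n M = Abs_cendo (\<lambda>u i. \<Sum>k<n. M $$ (i mod n, k) * u (n * (i div n) + k))"

lemma Rep_emb: "Rep_cendo (emb n M) = (\<lambda>u i. \<Sum>k<n. M $$ (i mod n, k) * u (n * (i div n) + k))"
  unfolding emb_def
  by (subst Abs_cendo_inverse) (simp_all add: sum.distrib sum_distrib_left algebra_simps)

lemma emb_add:
  assumes "n > 0" "A \<in> carrier_mat n n" "B \<in> carrier_mat n n"
  shows "emb n (A + B) = emb n A + emb n B"
  using assms by (simp add: Rep_cendo_inject[symmetric] Rep_emb Rep_cendo_ops fun_eq_iff
      sum.distrib[symmetric] algebra_simps)

lemma emb_scale:
  assumes "n > 0" "A \<in> carrier_mat n n"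
  shows "emb n (c \<cdot>\<^sub>m A) = cendo_scale c (emb n A)"
  using assms by (simp add: Rep_cendo_inject[symmetric] Rep_emb Rep_cendo_scale_cendo fun_eq_iff
      sum_distrib_left algebra_simps)

lemma emb_one: "n > 0 \<Longrightarrow> emb n (1\<^sub>m n) = 1"
  by (auto simp: Rep_cendo_inject[symmetric] Rep_emb Rep_cendo_ops fun_eq_iff if_distrib[of "\<lambda>x. x * _"]
      cong: if_cong)

lemma emb_zero: "n > 0 \<Longrightarrow> emb n (0\<^sub>m n n) = 0"
  by (simp add: Rep_cendo_inject[symmetric] Rep_emb Rep_cendo_ops fun_eq_iff)

lemma emb_mult:
  assumes n: "n > 0" and A: "A \<in> carrier_mat n n" and B: "B \<in> carrier_mat n n"
  shows "emb n (A * B) = emb n A * emb n B"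
proof -
  have "(\<Sum>k<n. (A * B) $$ (i mod n, k) * u (n * (i div n) + k)) =
    (\<Sum>k<n. A $$ (i mod n, k) * (\<Sum>l<n. B $$ (k, l) * u (n * (i div n) + l)))" for u i
  proof -
    have "(\<Sum>k<n. (A * B) $$ (i mod n, k) * u (n * (i div n) + k)) =
      (\<Sum>k<n. \<Sum>l<n. A $$ (i mod n, l) * B $$ (l, k) * u (n * (i div n) + k))"
      using n A B by (intro sum.cong) (auto simp: scalar_prod_def sum_distrib_right lessThan_atLeast0)
    also have "\<dots> = (\<Sum>l<n. \<Sum>k<n. A $$ (i mod n, l) * B $$ (l, k) * u (n * (i div n) + k))"
      by (rule sum.swap)
    finally show ?thesis by (simp add: sum_distrib_left mult.assoc)
  qed
  then show ?thesis using n
    by (simp add: Rep_cendo_inject[symmetric] Rep_emb Rep_cendo_ops fun_eq_iff)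
qed

lemma emb_inj:
  assumes "n > 0" "A \<in> carrier_mat n n" "B \<in> carrier_mat n n" "emb n A = emb n B"
  shows "A = B"
proof (rule eq_matI)
  fix i j assume ij: "i < dim_row B" "j < dim_col B"
  \<comment> \<open>A unit vector in the first block reads off column \<open>j\<close>: for
    \<open>i < n\<close> the block number \<open>i div n\<close> is 0.\<close>
  have "Rep_cendo (emb n A) (\<lambda>k. if k = j then 1 else 0) i = Rep_cendo (emb n B) (\<lambda>k. if k = j then 1 else 0) i"
    using assms(4) by simp
  then show "A $$ (i, j) = B $$ (i, j)"
    using ij assms(1-3) by (simp add: Rep_emb if_distrib[of "\<lambda>x. _ * x"] cong: if_cong)
qed (use assms in auto)

lemma emb_uminus:
  assumes "n > 0" "A \<in> carrier_mat n n"
  shows "emb n (- A) = - emb n A"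
proof -
  have "- A = (-1) \<cdot>\<^sub>m A" by (rule eq_matI) (use assms in auto)
  then show ?thesis using assms by (simp add: emb_scale)
qed

lemma emb_diff:
  assumes "n > 0" "A \<in> carrier_mat n n" "B \<in> carrier_mat n n"
  shows "emb n (A - B) = emb n A - emb n B"
proof -
  have "A - B = A + (- B)" by (rule eq_matI) (use assms in auto)
  then show ?thesis using assms by (simp add: emb_add emb_uminus)
qed

text \<open>Vectors become ring elements as the first columns of square matrices, so that a submodule turns
  into a set of ring elements that is closed under left multiplication by the represented operators.\<close>

definition vemb :: "nat \<Rightarrow> complex vec \<Rightarrow> cendo" where
  "vemb n v = emb n (mat n n (\<lambda>(i, j). if j = 0 then v $ i else 0))"

lemma vemb_add:
  assumes "n > 0" "v \<in> carrier_vec n" "w \<in> carrier_vec n"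
  shows "vemb n (v + w) = vemb n v + vemb n w"
  unfolding vemb_def using assms by (subst emb_add[symmetric]) (auto intro!: arg_cong[of _ _ "emb n"])

lemma vemb_scale:
  assumes "n > 0" "v \<in> carrier_vec n"
  shows "vemb n (c \<cdot>\<^sub>v v) = cendo_scale c (vemb n v)"
  unfolding vemb_def using assms by (subst emb_scale[symmetric]) (auto intro!: arg_cong[of _ _ "emb n"])

lemma vemb_mult:
  assumes "n > 0" "A \<in> carrier_mat n n" "v \<in> carrier_vec n"
  shows "vemb n (A *\<^sub>v v) = emb n A * vemb n v"
  unfolding vemb_def using assms
  by (subst emb_mult[symmetric]) (auto simp: scalar_prod_def intro!: arg_cong[of _ _ "emb n"])

lemma vemb_inj:
  assumes "n > 0" "v \<in> carrier_vec n" "w \<in> carrier_vec n" "vemb n v = vemb n w"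
  shows "v = w"
proof (rule eq_vecI)
  let ?V = "\<lambda>v. mat n n (\<lambda>(i, j). if j = 0 then v $ i else 0)"
  have e: "?V v = ?V w"
    using assms by (intro emb_inj[of n]) (auto simp: vemb_def)
  fix i assume "i < dim_vec w"
  then show "v $ i = w $ i" using arg_cong[OF e, of "\<lambda>M. M $$ (i, 0)"] assms by simp
qed (use assms in auto)

lemma vemb_zero: "n > 0 \<Longrightarrow> vemb n (0\<^sub>v n) = 0"
  unfolding vemb_def by (subst emb_zero[symmetric]) (auto intro!: arg_cong[of _ _ "emb n"])

section \<open>Generated algebras, their embedded images, and commutants\<close>

lemma gen_alg_carrier: "S \<subseteq> carrier_mat n n \<Longrightarrow> gen_alg n S \<subseteq> carrier_mat n n"
proof
  fix x assume "S \<subseteq> carrier_mat n n" "x \<in> gen_alg n S"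
  from this(2,1) show "x \<in> carrier_mat n n" by induction auto
qed

lemma gen_alg_least: "S \<subseteq> gen_alg n T \<Longrightarrow> gen_alg n S \<subseteq> gen_alg n T"
proof
  fix x assume "S \<subseteq> gen_alg n T" "x \<in> gen_alg n S"
  from this(2,1) show "x \<in> gen_alg n T" by induction (auto simp: gen_alg.intros)
qed

lemma subalg_emb:
  assumes n: "n > 0" and C: "C \<subseteq> carrier_mat n n" and one: "1\<^sub>m n \<in> C"
    and cl: "\<And>x y. x \<in> C \<Longrightarrow> y \<in> C \<Longrightarrow> x + y \<in> C" "\<And>x y. x \<in> C \<Longrightarrow> y \<in> C \<Longrightarrow> x * y \<in> C"
      "\<And>x c. x \<in> C \<Longrightarrow> c \<cdot>\<^sub>m x \<in> C"
  shows "cendo.subalg (emb n ` C)"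
  unfolding cendo.subalg_def
proof (intro conjI ballI allI)
  show "1 \<in> emb n ` C" using one emb_one[OF n] by (metis imageI)
  fix x assume "x \<in> emb n ` C"
  then obtain M where M: "M \<in> C" "x = emb n M" by blast
  show "cendo_scale c x \<in> emb n ` C" for c
    using M C cl(3) emb_scale[OF n, of M c] by (metis imageI subsetD)
  fix y assume "y \<in> emb n ` C"
  then obtain K where K: "K \<in> C" "y = emb n K" by blast
  show "x + y \<in> emb n ` C" using M K C cl(1) emb_add[OF n, of M K] by (metis imageI subsetD)
  show "x * y \<in> emb n ` C" using M K C cl(2) emb_mult[OF n, of M K] by (metis imageI subsetD)
qed

lemma subalg_emb_gen_alg: "n > 0 \<Longrightarrow> S \<subseteq> carrier_mat n n \<Longrightarrow> cendo.subalg (emb n ` gen_alg n S)"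
  by (rule subalg_emb) (simp_all add: gen_alg.intros gen_alg_carrier)

lemma subalg_emb_carrier: "n > 0 \<Longrightarrow> cendo.subalg (emb n ` carrier_mat n n)"
  by (rule subalg_emb) auto

lemma emb_memD:
  assumes "n > 0" "C \<subseteq> carrier_mat n n" "x \<in> carrier_mat n n" "emb n x \<in> emb n ` C"
  shows "x \<in> C"
proof -
  obtain y where y: "y \<in> C" "emb n x = emb n y" using assms(4) by blast
  have "x = y" by (rule emb_inj[OF assms(1,3) _ y(2)]) (use y(1) assms(2) in blast)
  then show ?thesis using y(1) by simp
qed

lemma central_mat_scalar:
  fixes M :: "complex mat"
  assumes n: "n > 0" and M: "M \<in> carrier_mat n n"
    and comm: "\<And>X. X \<in> carrier_mat n n \<Longrightarrow> M * X = X * M"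
  shows "\<exists>c. M = c \<cdot>\<^sub>m 1\<^sub>m n"
proof (intro exI[of _ "M $$ (0, 0)"] eq_matI)
  fix i j assume "i < dim_row (M $$ (0, 0) \<cdot>\<^sub>m 1\<^sub>m n)" "j < dim_col (M $$ (0, 0) \<cdot>\<^sub>m 1\<^sub>m n)"
  then have ij: "i < n" "j < n" by auto
  \<comment> \<open>With this matrix unit, entry \<open>(i, 0)\<close> of \<open>M * ?E\<close> is
    \<open>M $$ (i, j)\<close>, while that of \<open>?E * M\<close> is \<open>M $$ (0, 0)\<close> if
    \<open>i = j\<close> and 0 otherwise.\<close>
  let ?E = "mat n n (\<lambda>(a, b). if a = j \<and> b = 0 then 1 else 0) :: complex mat"
  have "(M * ?E) $$ (i, 0) = (\<Sum>k<n. M $$ (i, k) * (if k = j then 1 else 0))"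
    using M n ij by (simp add: scalar_prod_def lessThan_atLeast0)
  also have "\<dots> = M $$ (i, j)" using ij by (simp add: if_distrib[of "\<lambda>x. _ * x"] cong: if_cong)
  finally have 1: "(M * ?E) $$ (i, 0) = M $$ (i, j)" .
  have "M $$ (i, j) = (?E * M) $$ (i, 0)" using 1 comm[of ?E] by simp
  also have "(?E * M) $$ (i, 0) = (\<Sum>k<n. (if i = j \<and> k = 0 then 1 else 0) * M $$ (k, 0))"
    using M n ij by (simp add: scalar_prod_def lessThan_atLeast0)
  also have "\<dots> = (\<Sum>k<n. if k = 0 then (if i = j then M $$ (0, 0) else 0) else 0)"
    by (intro sum.cong refl) auto
  also have "\<dots> = (if i = j then M $$ (0, 0) else 0)" using n by simp
  finally show "M $$ (i, j) = (M $$ (0, 0) \<cdot>\<^sub>m 1\<^sub>m n) $$ (i, j)"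
    using ij by simp
qed (use M in auto)

lemma commutant_gen_alg:
  assumes S: "S \<subseteq> carrier_mat n n" and M: "M \<in> carrier_mat n n"
    and comm: "\<And>s. s \<in> S \<Longrightarrow> M * s = s * M" and x: "x \<in> gen_alg n S"
  shows "M * x = x * M"
  using x
proof induction
  case (add x y)
  then have "x \<in> carrier_mat n n" "y \<in> carrier_mat n n" using gen_alg_carrier[OF S] by auto
  then show ?case using add.IH M by (simp add: mult_add_distrib_mat[of _ n n] add_mult_distrib_mat[of _ n n])
next
  case (smult x c)
  then have "x \<in> carrier_mat n n" using gen_alg_carrier[OF S] by auto
  then show ?case using smult.IH M by (simp add: mult_smult_distrib[of _ n n] mult_smult_assoc_mat[of _ n n])
next
  case (mult x y)
  then have xy: "x \<in> carrier_mat n n" "y \<in> carrier_mat n n" using gen_alg_carrier[OF S] by auto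
  have "M * (x * y) = M * x * y" by (rule assoc_mult_mat[OF M xy, symmetric])
  also have "\<dots> = x * M * y" by (simp only: mult.IH(1))
  also have "\<dots> = x * (M * y)" by (rule assoc_mult_mat[OF xy(1) M xy(2)])
  also have "\<dots> = x * (y * M)" by (simp only: mult.IH(2))
  also have "\<dots> = x * y * M" by (rule assoc_mult_mat[OF xy M, symmetric])
  finally show ?case .
qed (use M comm in auto)

subsection \<open>The symplectic Lie algebra in fermion bilinears\<close>

text \<open>Canonical anticommutation relations: \<open>p i\<close> behaves as exterior
  multiplication by a basis vector of \<open>V\<close> and \<open>q i\<close> as the dual
  contraction, so that \<open>p i * q k\<close> represents a matrix unit of gl(V) on the exterior
  algebra.\<close>

locale car = calg scale
  for scale :: "complex \<Rightarrow> 'a::ring_1 \<Rightarrow> 'a" (infixr "*s" 75) +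
  fixes L :: nat and p q :: "nat \<Rightarrow> 'a"
  assumes pp: "i < 2*L \<Longrightarrow> k < 2*L \<Longrightarrow> p i * p k = - (p k * p i)"
    and qq: "i < 2*L \<Longrightarrow> k < 2*L \<Longrightarrow> q i * q k = - (q k * q i)"
    and qp: "i < 2*L \<Longrightarrow> k < 2*L \<Longrightarrow> q i * p k = (if i = k then 1 else 0) - p k * q i"
begin

text \<open>The commutation relations of matrix units. Moving \<open>q\<close> past \<open>p\<close>
  leaves a quartic term in each product; exchanging the two \<open>p\<close> and the two
  \<open>q\<close> costs two signs, so these terms agree and cancel.\<close>

lemma bracket_pq:
  assumes "i < 2*L" "k < 2*L" "l < 2*L" "m < 2*L"
  shows "p i * q k * (p l * q m) - p l * q m * (p i * q k) =
    (if k = l then p i * q m else 0) - (if m = i then p l * q k else 0)"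
proof -
  have "p i * q k * (p l * q m) = p i * (q k * p l) * q m"
    by (simp add: mult.assoc)
  also have "\<dots> = (if k = l then p i * q m else 0) - p i * p l * (q k * q m)"
    by (subst qp) (use assms in \<open>auto simp: algebra_simps\<close>)
  finally have 1: "p i * q k * (p l * q m) = (if k = l then p i * q m else 0) - p i * p l * (q k * q m)" .
  have "p l * q m * (p i * q k) = p l * (q m * p i) * q k"
    by (simp add: mult.assoc)
  also have "\<dots> = (if m = i then p l * q k else 0) - p l * p i * (q m * q k)"
    by (subst qp) (use assms in \<open>auto simp: algebra_simps\<close>)
  also have "p l * p i * (q m * q k) = p i * p l * (q k * q m)"
    using assms pp[of l i] qq[of m k] by simp
  finally show ?thesis using 1 by simp
qed

definition bil :: "(nat \<Rightarrow> nat \<Rightarrow> complex) \<Rightarrow> 'a" where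
  "bil X = (\<Sum>i<2*L. \<Sum>k<2*L. X i k *s (p i * q k))"

lemma bil_cong: "(\<And>i k. i < 2*L \<Longrightarrow> k < 2*L \<Longrightarrow> X i k = Y i k) \<Longrightarrow> bil X = bil Y"
  unfolding bil_def by (intro sum.cong) auto

lemma bil_lin: "bil (\<lambda>i k. a * X i k + b * Y i k) = a *s bil X + b *s bil Y"
  by (simp add: bil_def scale_sum_right scale_left_distrib sum.distrib)

lemma bil_mult:
  "bil X * bil Y = (\<Sum>i<2*L. \<Sum>k<2*L. \<Sum>l<2*L. \<Sum>m<2*L. (X i k * Y l m) *s (p i * q k * (p l * q m)))"
proof -
  have "bil X * bil Y = (\<Sum>i<2*L. \<Sum>k<2*L. (X i k *s (p i * q k)) * bil Y)"
    by (simp add: bil_def[of X] sum_distrib_right)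
  also have "\<dots> = (\<Sum>i<2*L. \<Sum>k<2*L. \<Sum>l<2*L. \<Sum>m<2*L. (X i k * Y l m) *s (p i * q k * (p l * q m)))"
    by (simp add: bil_def sum_distrib_left scale_mult_left scale_mult_right scale_sum_right mult.commute[of "Y _ _"])
  finally show ?thesis .
qed

lemma bil_bracket:
  "bil X * bil Y - bil Y * bil X = bil (\<lambda>i k. (\<Sum>l<2*L. X i l * Y l k) - (\<Sum>l<2*L. Y i l * X l k))"
proof -
  let ?I = "{..<2*L}"
  have "bil Y * bil X = (\<Sum>l\<in>?I. \<Sum>m\<in>?I. \<Sum>i\<in>?I. \<Sum>k\<in>?I. (X i k * Y l m) *s (p l * q m * (p i * q k)))"
    by (simp add: bil_mult mult.commute)
  also have "\<dots> = (\<Sum>l\<in>?I. \<Sum>i\<in>?I. \<Sum>m\<in>?I. \<Sum>k\<in>?I. (X i k * Y l m) *s (p l * q m * (p i * q k)))"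
    by (intro sum.cong refl sum.swap)
  also have "\<dots> = (\<Sum>i\<in>?I. \<Sum>l\<in>?I. \<Sum>m\<in>?I. \<Sum>k\<in>?I. (X i k * Y l m) *s (p l * q m * (p i * q k)))"
    by (rule sum.swap)
  also have "\<dots> = (\<Sum>i\<in>?I. \<Sum>l\<in>?I. \<Sum>k\<in>?I. \<Sum>m\<in>?I. (X i k * Y l m) *s (p l * q m * (p i * q k)))"
    by (intro sum.cong refl sum.swap)
  also have "\<dots> = (\<Sum>i\<in>?I. \<Sum>k\<in>?I. \<Sum>l\<in>?I. \<Sum>m\<in>?I. (X i k * Y l m) *s (p l * q m * (p i * q k)))"
    by (intro sum.cong refl sum.swap)
  finally have "bil X * bil Y - bil Y * bil X = (\<Sum>i\<in>?I. \<Sum>k\<in>?I. \<Sum>l\<in>?I. \<Sum>m\<in>?I.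
      (X i k * Y l m) *s (p i * q k * (p l * q m) - p l * q m * (p i * q k)))"
    by (simp add: bil_mult sum_subtractf scale_right_diff_distrib)
  also have "\<dots> = (\<Sum>i\<in>?I. \<Sum>k\<in>?I. \<Sum>l\<in>?I. \<Sum>m\<in>?I.
      (if k = l then (X i k * Y l m) *s (p i * q m) else 0) -
      (if m = i then (X i k * Y l m) *s (p l * q k) else 0))"
    by (intro sum.cong refl) (simp add: bracket_pq scale_right_diff_distrib)
  also have "\<dots> = (\<Sum>i\<in>?I. \<Sum>k\<in>?I. \<Sum>l\<in>?I. \<Sum>m\<in>?I. if k = l then (X i k * Y l m) *s (p i * q m) else 0) -
     (\<Sum>i\<in>?I. \<Sum>k\<in>?I. \<Sum>l\<in>?I. \<Sum>m\<in>?I. if m = i then (X i k * Y l m) *s (p l * q k) else 0)"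
    by (simp only: sum_subtractf)
  also have "(\<Sum>i\<in>?I. \<Sum>k\<in>?I. \<Sum>l\<in>?I. \<Sum>m\<in>?I. if k = l then (X i k * Y l m) *s (p i * q m) else 0) =
      (\<Sum>i\<in>?I. \<Sum>k\<in>?I. \<Sum>m\<in>?I. (X i k * Y k m) *s (p i * q m))"
  proof (rule sum.cong[OF refl], rule sum.cong[OF refl])
    fix i k assume "k \<in> ?I"
    have "(\<Sum>l\<in>?I. \<Sum>m\<in>?I. if k = l then (X i k * Y l m) *s (p i * q m) else 0) =
      (\<Sum>l\<in>?I. if k = l then (\<Sum>m\<in>?I. (X i k * Y l m) *s (p i * q m)) else 0)"
      by (intro sum.cong refl) auto
    then show "(\<Sum>l\<in>?I. \<Sum>m\<in>?I. if k = l then (X i k * Y l m) *s (p i * q m) else 0) =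
      (\<Sum>m\<in>?I. (X i k * Y k m) *s (p i * q m))" using \<open>k \<in> ?I\<close> by simp
  qed
  also have "\<dots> = (\<Sum>i\<in>?I. \<Sum>m\<in>?I. \<Sum>k\<in>?I. (X i k * Y k m) *s (p i * q m))"
    by (intro sum.cong refl sum.swap)
  also have "\<dots> = bil (\<lambda>i k. \<Sum>l\<in>?I. X i l * Y l k)"
    by (simp add: bil_def scale_sum_left)
  also have "(\<Sum>i\<in>?I. \<Sum>k\<in>?I. \<Sum>l\<in>?I. \<Sum>m\<in>?I. if m = i then (X i k * Y l m) *s (p l * q k) else 0) =
      (\<Sum>i\<in>?I. \<Sum>k\<in>?I. \<Sum>l\<in>?I. (Y l i * X i k) *s (p l * q k))"
    by (intro sum.cong refl) (simp add: mult.commute)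
  also have "\<dots> = (\<Sum>i\<in>?I. \<Sum>l\<in>?I. \<Sum>k\<in>?I. (Y l i * X i k) *s (p l * q k))"
    by (intro sum.cong refl sum.swap)
  also have "\<dots> = (\<Sum>l\<in>?I. \<Sum>i\<in>?I. \<Sum>k\<in>?I. (Y l i * X i k) *s (p l * q k))"
    by (rule sum.swap)
  also have "\<dots> = (\<Sum>l\<in>?I. \<Sum>k\<in>?I. \<Sum>i\<in>?I. (Y l i * X i k) *s (p l * q k))"
    by (intro sum.cong refl sum.swap)
  also have "\<dots> = bil (\<lambda>i k. \<Sum>l\<in>?I. Y i l * X l k)"
    by (simp add: bil_def scale_sum_left)
  finally show ?thesis
    by (simp add: bil_def sum_subtractf scale_left_diff_distrib)
qed

section \<open>The symplectic form, and sp as the symmetric bilinears\<close>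

definition bar :: "nat \<Rightarrow> nat" where
  "bar i = (if i < L then i + L else i - L)"

text \<open>Row \<open>i\<close> of \<open>sympJ L\<close> has its only nonzero entry in column
  \<open>bar i\<close>, and this entry is \<open>sg i\<close>.\<close>

definition sg :: "nat \<Rightarrow> complex" where
  "sg i = (if i < L then 1 else -1)"

lemma bar_less: "i < 2*L \<Longrightarrow> bar i < 2*L"
  and bar_bar: "i < 2*L \<Longrightarrow> bar (bar i) = i"
  and sg_bar: "i < 2*L \<Longrightarrow> sg (bar i) = - sg i"
  and sg_sg: "sg i * sg i = 1"
  and sg_sgl: "sg i * (sg i * x) = x"
  by (auto simp: bar_def sg_def)

lemma bij_bar: "bij_betw bar {..<2*L} {..<2*L}"
  by (rule bij_betw_byWitness[of _ bar]) (auto simp: bar_bar bar_less)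

lemma sum_bar: "(\<Sum>i<2*L. g (bar i)) = (\<Sum>i<2*L. g i)"
  using sum.reindex_bij_betw[OF bij_bar] .

text \<open>The form identifies \<open>V\<close> with its dual; \<open>chi i\<close> is the
  contraction that corresponds to basis vector \<open>i\<close>. In terms of products
  \<open>p i * chi k\<close>, membership in sp becomes symmetry of the coefficients.\<close>

definition chi :: "nat \<Rightarrow> 'a" where
  "chi i = - sg i *s q (bar i)"

lemma q_eq_chi: "i < 2*L \<Longrightarrow> q (bar i) = - sg i *s chi i"
  by (simp add: chi_def sg_sg)

definition quad :: "(nat \<Rightarrow> nat \<Rightarrow> complex) \<Rightarrow> 'a" where
  "quad S = (\<Sum>i<2*L. \<Sum>k<2*L. S i k *s (p i * chi k))"

definition sp_elt :: "nat \<Rightarrow> nat \<Rightarrow> 'a" where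
  "sp_elt i k = p i * chi k + p k * chi i"

lemma bil_eq_quad: "bil X = quad (\<lambda>i k. - sg k * X i (bar k))"
proof -
  have "(\<Sum>k<2*L. X i k *s (p i * q k)) = (\<Sum>k<2*L. (- sg k * X i (bar k)) *s (p i * chi k))" for i
    by (subst sum_bar[symmetric], intro sum.cong refl)
       (simp add: q_eq_chi scale_mult_right scale_mult_left mult.commute)
  then show ?thesis by (simp add: bil_def quad_def)
qed

lemma quad_sym:
  assumes "\<And>i k. i < 2*L \<Longrightarrow> k < 2*L \<Longrightarrow> S i k = S k i"
  shows "quad S = (1/2) *s (\<Sum>i<2*L. \<Sum>k<2*L. S i k *s sp_elt i k)"
proof -
  have "quad S = (\<Sum>i<2*L. \<Sum>k<2*L. S i k *s (p k * chi i))"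
    unfolding quad_def by (subst sum.swap) (intro sum.cong refl, simp add: assms)
  then have "quad S + quad S = (\<Sum>i<2*L. \<Sum>k<2*L. S i k *s sp_elt i k)"
    by (simp add: quad_def sp_elt_def scale_right_distrib sum.distrib)
  then have "(\<Sum>i<2*L. \<Sum>k<2*L. S i k *s sp_elt i k) = 2 *s quad S"
    using scale_left_distrib[of 1 1 "quad S"] by simp
  then show ?thesis by simp
qed

lemma quad_delta:
  assumes "a < 2*L" "b < 2*L"
  shows "quad (\<lambda>i k. (if i = a \<and> k = b then 1 else 0) + (if i = b \<and> k = a then 1 else 0)) = sp_elt a b"
proof -
  have *: "quad (\<lambda>i k. if i = a \<and> k = b then 1 else 0) = p a * chi b" if "a < 2*L" "b < 2*L" for a b
  proof -
    have "(\<Sum>k<2*L. (if i = a \<and> k = b then 1 else 0) *s (p i * chi k)) =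
      (if i = a then p a * chi b else 0)" for i
      using that by (cases "i = a") (simp_all add: if_distrib[of "\<lambda>c. c *s _"] cong: if_cong)
    then show ?thesis using that by (simp add: quad_def)
  qed
  show ?thesis using *[of a b] *[of b a] assms
    by (simp add: sp_elt_def quad_def scale_left_distrib sum.distrib)
qed

lemma quad_outer: "quad (\<lambda>i k. a i * b k) = (\<Sum>i<2*L. a i *s p i) * (\<Sum>k<2*L. b k *s chi k)"
  by (simp add: quad_def mult_sum_scale)

definition rho :: "complex mat \<Rightarrow> 'a" where
  "rho X = bil (\<lambda>i k. X $$ (i, k))"

text \<open>The condition is, up to sign, the symmetry in \<open>i\<close> and \<open>k\<close> of
  the coefficients that \<open>bil_eq_quad\<close> attaches to \<open>X\<close>.\<close>

lemma sp_alg_iff: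
  "X \<in> sp_alg L \<longleftrightarrow> X \<in> carrier_mat (2*L) (2*L) \<and>
    (\<forall>i<2*L. \<forall>k<2*L. sg k * X $$ (i, bar k) = sg i * X $$ (k, bar i))"
proof (cases "X \<in> carrier_mat (2*L) (2*L)")
  case X: True
  have J: "sympJ L $$ (i, k) = (if k = bar i then sg i else 0)" if "i < 2*L" "k < 2*L" for i k
    using that by (auto simp: sympJ_def bar_def sg_def)
  have JX: "(sympJ L * X) $$ (i, k) = sg i * X $$ (bar i, k)" if "i < 2*L" "k < 2*L" for i k
  proof -
    have "(sympJ L * X) $$ (i, k) = (\<Sum>l<2*L. sympJ L $$ (i, l) * X $$ (l, k))"
      using that X by (simp add: sympJ_def scalar_prod_def lessThan_atLeast0)
    also have "\<dots> = (\<Sum>l<2*L. if l = bar i then sg i * X $$ (l, k) else 0)"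
      using that by (intro sum.cong refl) (simp add: J)
    finally show ?thesis using bar_less[OF that(1)] by simp
  qed
  have XJ: "(transpose_mat X * sympJ L) $$ (i, k) = - sg k * X $$ (bar k, i)" if "i < 2*L" "k < 2*L" for i k
  proof -
    have "(transpose_mat X * sympJ L) $$ (i, k) = (\<Sum>l<2*L. X $$ (l, i) * sympJ L $$ (l, k))"
      using that X by (simp add: sympJ_def scalar_prod_def lessThan_atLeast0)
    also have "\<dots> = (\<Sum>l<2*L. if l = bar k then - sg k * X $$ (l, i) else 0)"
      using that by (intro sum.cong refl) (auto simp: J bar_bar sg_bar)
    finally show ?thesis using bar_less[OF that(2)] by simp
  qed
  have J_dim: "dim_row (sympJ L) = 2*L" "dim_col (sympJ L) = 2*L"
    by (simp_all add: sympJ_def)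
  have entry: "(transpose_mat X * sympJ L + sympJ L * X) $$ (i, k) = sg i * X $$ (bar i, k) - sg k * X $$ (bar k, i)"
    if "i < 2*L" "k < 2*L" for i k
    using that X J_dim by (simp add: JX XJ del: index_mult_mat(1))
  have zero: "M = 0\<^sub>m (2*L) (2*L) \<longleftrightarrow> (\<forall>i<2*L. \<forall>k<2*L. M $$ (i, k) = 0)"
    if "M \<in> carrier_mat (2*L) (2*L)" for M :: "complex mat"
    using that by (auto intro!: eq_matI)
  have "transpose_mat X * sympJ L + sympJ L * X = 0\<^sub>m (2*L) (2*L) \<longleftrightarrow>
     (\<forall>i<2*L. \<forall>k<2*L. (transpose_mat X * sympJ L + sympJ L * X) $$ (i, k) = 0)"
    using X by (intro zero carrier_matI) (simp_all add: sympJ_def)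
  also have "\<dots> \<longleftrightarrow> (\<forall>i<2*L. \<forall>k<2*L. sg i * X $$ (bar i, k) = sg k * X $$ (bar k, i))"
    using entry by auto
  also have "\<dots> \<longleftrightarrow> (\<forall>i<2*L. \<forall>k<2*L. sg k * X $$ (i, bar k) = sg i * X $$ (k, bar i))"
    (is "?A \<longleftrightarrow> ?B")
  proof
    assume A: ?A
    show ?B
    proof (intro allI impI)
      fix i k assume ik: "i < 2*L" "k < 2*L"
      \<comment> \<open>Passing to \<open>bar i\<close> and \<open>bar k\<close> moves
        \<open>bar\<close> to the column index and flips both signs; the factor
        \<open>sg i * sg k\<close> then clears the signs and exchanges their places.\<close>
      have "- sg i * X $$ (i, bar k) = - sg k * X $$ (k, bar i)"
        using A[rule_format, OF bar_less[OF ik(1)] bar_less[OF ik(2)]] ik by (simp add: bar_bar sg_bar)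
      then have "sg i * sg k * (- sg i * X $$ (i, bar k)) = sg i * sg k * (- sg k * X $$ (k, bar i))"
        by simp
      then show "sg k * X $$ (i, bar k) = sg i * X $$ (k, bar i)"
        by (simp add: sg_sgl mult_ac)
    qed
  next
    assume B: ?B
    show ?A
    proof (intro allI impI)
      fix i k assume ik: "i < 2*L" "k < 2*L"
      have "- sg k * X $$ (bar i, k) = - sg i * X $$ (bar k, i)"
        using B[rule_format, OF bar_less[OF ik(1)] bar_less[OF ik(2)]] ik by (simp add: bar_bar sg_bar)
      then have "sg i * sg k * (- sg k * X $$ (bar i, k)) = sg i * sg k * (- sg i * X $$ (bar k, i))"
        by simp
      then show "sg i * X $$ (bar i, k) = sg k * X $$ (bar k, i)"
        by (simp add: sg_sgl mult_ac)
    qed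
  qed
  finally show ?thesis using X by (simp add: sp_alg_def)
qed (simp add: sp_alg_def)

lemma rho_quad:
  assumes "X \<in> sp_alg L"
  shows "rho X = quad (\<lambda>i k. - sg k * X $$ (i, bar k))"
    and "i < 2*L \<Longrightarrow> k < 2*L \<Longrightarrow> - sg k * X $$ (i, bar k) = - sg i * X $$ (k, bar i)"
  using assms by (simp_all add: rho_def bil_eq_quad sp_alg_iff)

lemma quad_in_rho:
  assumes S: "\<And>i k. i < 2*L \<Longrightarrow> k < 2*L \<Longrightarrow> S i k = S k i"
  shows "quad S \<in> rho ` sp_alg L"
proof
  let ?X = "mat (2*L) (2*L) (\<lambda>(i, k). sg k * S i (bar k))"
  have *: "?X $$ (i, bar k) = - sg k * S i k" if "i < 2*L" "k < 2*L" for i k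
    using that by (simp add: bar_less bar_bar sg_bar)
  show "?X \<in> sp_alg L"
    unfolding sp_alg_iff by (auto simp: * sg_sgl S simp del: index_mat)
  show "quad S = rho ?X"
    unfolding rho_def bil_eq_quad quad_def
    by (intro sum.cong refl arg_cong2[of _ _ _ _ "(*s)"]) (auto simp: * sg_sgl simp del: index_mat)
qed

lemma sp_elt_in_rho:
  assumes "i < 2*L" "k < 2*L"
  shows "sp_elt i k \<in> rho ` sp_alg L"
  by (subst quad_delta[OF assms, symmetric], rule quad_in_rho) (simp add: add.commute conj_commute)

lemma rho_lin:
  assumes "X \<in> sp_alg L" "Y \<in> sp_alg L"
  shows "rho (a \<cdot>\<^sub>m X + b \<cdot>\<^sub>m Y) = a *s rho X + b *s rho Y"
  unfolding rho_def bil_lin[symmetric] using assms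
  by (intro bil_cong) (auto simp: sp_alg_def)

lemma rho_bracket:
  assumes "X \<in> sp_alg L" "Y \<in> sp_alg L"
  shows "rho (lie_bracket X Y) = rho X * rho Y - rho Y * rho X"
  unfolding rho_def bil_bracket using assms
  by (intro bil_cong) (auto simp: sp_alg_def lie_bracket_def scalar_prod_def lessThan_atLeast0)

end

subsection \<open>Weights\<close>

context car
begin

definition num :: "nat \<Rightarrow> 'a" where
  "num i = p i * q i"

definition h :: "nat \<Rightarrow> 'a" where
  "h l = num l - num (l + L)"

text \<open>Coordinate \<open>l\<close> of the weight of the \<open>i\<close>-th basis vector of
  \<open>V\<close>: a unit vector for \<open>i < L\<close>, the negative of one for the upper half
  of the indices.\<close>

definition eps :: "nat \<Rightarrow> nat \<Rightarrow> int" where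
  "eps l i = (if i = l then 1 else 0) - (if i = l + L then 1 else 0)"

lemma p_p_zero: "i < 2*L \<Longrightarrow> p i * p i = 0"
  and q_q_zero: "i < 2*L \<Longrightarrow> q i * q i = 0"
  by (rule double_eq_zero, rule pp; assumption) (rule double_eq_zero, rule qq; assumption)

lemma num_p: "i < 2*L \<Longrightarrow> num i * p i = p i"
  unfolding num_def by (simp add: mult.assoc qp right_diff_distrib) (simp add: mult.assoc[symmetric] p_p_zero)

lemma q_num: "i < 2*L \<Longrightarrow> q i * num i = q i"
  unfolding num_def by (simp add: mult.assoc[symmetric] qp left_diff_distrib) (simp add: mult.assoc q_q_zero)

lemma p_num: "i < 2*L \<Longrightarrow> p i * num i = 0"
  and num_q: "i < 2*L \<Longrightarrow> num i * q i = 0"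
  unfolding num_def using p_p_zero q_q_zero by (simp_all add: mult.assoc) (simp add: mult.assoc[symmetric])

lemma num_p_other: "i < 2*L \<Longrightarrow> k < 2*L \<Longrightarrow> i \<noteq> k \<Longrightarrow> num i * p k = p k * num i"
  unfolding num_def by (simp add: mult.assoc qp) (simp add: mult.assoc[symmetric] pp[of i k])

lemma num_q_other: "i < 2*L \<Longrightarrow> k < 2*L \<Longrightarrow> i \<noteq> k \<Longrightarrow> num i * q k = q k * num i"
  unfolding num_def by (simp add: mult.assoc[symmetric] qp) (simp add: mult.assoc qq[of i k])

lemma num_idem: "i < 2*L \<Longrightarrow> num i * num i = num i"
  using num_p[of i] by (simp add: num_def mult.assoc[symmetric])

lemma num_commute:
  assumes "i < 2*L" "k < 2*L"
  shows "num i * num k = num k * num i"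
proof (cases "i = k")
  case False
  have "num i * num k = num i * p k * q k" by (simp add: num_def[of k] mult.assoc)
  also have "\<dots> = p k * (num i * q k)" by (simp add: num_p_other assms False mult.assoc)
  also have "\<dots> = num k * num i" by (simp add: num_q_other assms False num_def[of k] mult.assoc)
  finally show ?thesis .
qed simp

lemma h_pq:
  assumes "l < L" "i < 2*L" "k < 2*L"
  shows "h l * (p i * q k) - p i * q k * h l = of_int (eps l i - eps l k) *s (p i * q k)"
proof -
  have *: "num a * (p i * q k) - p i * q k * num a = of_int ((if i = a then 1 else 0) - (if k = a then 1 else 0)) *s (p i * q k)"
    if "a < 2*L" for a
    using bracket_pq[of a a i k] that assms by (auto simp: num_def)
  have "h l * (p i * q k) - p i * q k * h l =
    (num l * (p i * q k) - p i * q k * num l) - (num (l + L) * (p i * q k) - p i * q k * num (l + L))"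
    by (simp add: h_def left_diff_distrib right_diff_distrib)
  also have "\<dots> = of_int (eps l i - eps l k) *s (p i * q k)"
  proof -
    have less: "l < 2*L" "l + L < 2*L" using assms by auto
    show ?thesis
      unfolding *[OF less(1)] *[OF less(2)] scale_left_diff_distrib[symmetric]
      by (rule arg_cong[of _ _ "\<lambda>c. c *s _"]) (simp add: eps_def)
  qed
  finally show ?thesis .
qed

lemma eps_bar: "l < L \<Longrightarrow> k < 2*L \<Longrightarrow> eps l (bar k) = - eps l k"
  by (auto simp: eps_def bar_def)

lemma h_sp_elt:
  assumes "l < L" "i < 2*L" "k < 2*L"
  shows "h l * sp_elt i k = sp_elt i k * h l + of_int (eps l i + eps l k) *s sp_elt i k"
proof -
  have *: "h l * (p i * chi k) - p i * chi k * h l = of_int (eps l i + eps l k) *s (p i * chi k)"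
    if "i < 2*L" "k < 2*L" for i k
  proof -
    have "h l * (p i * chi k) - p i * chi k * h l = - sg k *s (h l * (p i * q (bar k)) - p i * q (bar k) * h l)"
      by (simp add: chi_def scale_mult_left scale_mult_right scale_right_diff_distrib)
    then show ?thesis using that assms(1)
      by (simp add: h_pq bar_less eps_bar) (simp add: chi_def scale_mult_right mult.commute)
  qed
  have "h l * sp_elt i k - sp_elt i k * h l =
      (h l * (p i * chi k) - p i * chi k * h l) + (h l * (p k * chi i) - p k * chi i * h l)"
    by (simp add: sp_elt_def distrib_left distrib_right)
  also have "\<dots> = of_int (eps l i + eps l k) *s sp_elt i k"
    unfolding *[OF assms(2,3)] *[OF assms(3,2)] sp_elt_def scale_right_distrib by (simp add: add.commute)
  finally show ?thesis by (simp add: diff_eq_eq add.commute)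
qed

lemma h_eq_sp_elt: "l < L \<Longrightarrow> h l = sp_elt l (l + L)"
  by (simp add: h_def sp_elt_def chi_def bar_def sg_def num_def)

lemma h_commute: "l < L \<Longrightarrow> m < L \<Longrightarrow> h l * h m = h m * h l"
  using num_commute[of l m] num_commute[of l "m + L"] num_commute[of "l + L" m] num_commute[of "l + L" "m + L"]
  by (simp add: h_def left_diff_distrib right_diff_distrib)

text \<open>Applied to \<open>h l\<close>, a difference of commuting idempotents. The relation
  \<open>x^3 = x\<close> confines weights to -1, 0, 1 and also supplies the eigenprojections, so no
  existence theorem for eigenvalues is called for.\<close>

lemma idem_cube:
  fixes n m :: 'a
  assumes "n * n = n" "m * m = m" "m * n = n * m"
  shows "(n - m) * (n - m) = n + m - (n * m + n * m)"
    and "(n - m) * ((n - m) * (n - m)) = n - m"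
proof -
  show sq: "(n - m) * (n - m) = n + m - (n * m + n * m)"
    by (simp add: left_diff_distrib right_diff_distrib assms)
  have "n * (n * m) = n * m" by (simp only: mult.assoc[symmetric] assms(1))
  moreover have "m * (n * m) = n * m" by (simp only: mult.assoc[symmetric] assms(3)) (simp only: mult.assoc assms(2))
  ultimately show "(n - m) * ((n - m) * (n - m)) = n - m"
    unfolding sq by (simp add: left_diff_distrib right_diff_distrib distrib_left assms)
qed

lemma h_square:
  assumes "l < L"
  shows "h l * h l = num l + num (l + L) - (num l * num (l + L) + num l * num (l + L))"
  unfolding h_def using assms by (simp add: idem_cube(1) num_idem num_commute[of "l + L" l])

lemma h_cube:
  assumes "l < L"
  shows "h l * (h l * h l) = h l"
  unfolding h_def using assms by (simp add: idem_cube(2) num_idem num_commute[of "l + L" l])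

section \<open>Weight vectors and highest weights of submodules\<close>

definition spmod :: "'a set \<Rightarrow> bool" where
  "spmod W \<longleftrightarrow> 0 \<in> W \<and> (\<forall>v\<in>W. \<forall>w\<in>W. v + w \<in> W) \<and> (\<forall>v\<in>W. \<forall>c. c *s v \<in> W) \<and>
    (\<forall>i<2*L. \<forall>k<2*L. \<forall>v\<in>W. sp_elt i k * v \<in> W)"

definition wt :: "(nat \<Rightarrow> int) \<Rightarrow> 'a \<Rightarrow> bool" where
  "wt \<theta> v \<longleftrightarrow> (\<forall>l<L. h l * v = of_int (\<theta> l) *s v)"

lemma spmod_h: "spmod W \<Longrightarrow> l < L \<Longrightarrow> v \<in> W \<Longrightarrow> h l * v \<in> W"
  by (simp add: h_eq_sp_elt spmod_def)

lemma spmod_diff: "spmod W \<Longrightarrow> v \<in> W \<Longrightarrow> w \<in> W \<Longrightarrow> v - w \<in> W"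
  unfolding spmod_def by (metis add_uminus_conv_diff scale_minus_left scale_one)

lemma exists_wt:
  assumes W: "spmod W" and ne: "v \<in> W" "v \<noteq> 0"
  shows "\<exists>w\<in>W. w \<noteq> 0 \<and> (\<exists>\<theta>. wt \<theta> w)"
proof -
  have "m \<le> L \<Longrightarrow> \<exists>w\<in>W. w \<noteq> 0 \<and> (\<exists>\<theta>::nat \<Rightarrow> int. \<forall>l<m. h l * w = of_int (\<theta> l) *s w)" for m
  proof (induction m)
    case 0
    then show ?case using ne by auto
  next
    case (Suc m)
    then obtain w and \<theta> :: "nat \<Rightarrow> int" where w: "w \<in> W" "w \<noteq> 0" and l: "\<And>l. l < m \<Longrightarrow> h l * w = of_int (\<theta> l) *s w"
      by auto
    have m: "m < L" using Suc.prems by simp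
    \<comment> \<open>By \<open>h_cube\<close>, the vectors \<open>w - b\<close>,
      \<open>b + a\<close> and \<open>b - a\<close> are eigenvectors of \<open>h m\<close> for 0, 1
      and -1, or zero. They cannot all vanish, since that would force \<open>b = - b\<close> and
      \<open>w = b = 0\<close>. They keep the earlier eigenvalues because the \<open>h l\<close>
      commute.\<close>
    define a where "a = h m * w"
    define b where "b = h m * a"
    have ab: "a \<in> W" "b \<in> W" using W w m by (auto simp: a_def b_def spmod_h)
    have "h m * b = h m * (h m * h m) * w" by (simp only: a_def b_def mult.assoc)
    then have hb: "h m * b = a" by (simp only: h_cube[OF m] a_def)
    have comm: "h l * (h m * x) = h m * (h l * x)" if "l < m" for l x
      using that m by (simp add: mult.assoc[symmetric] h_commute[of l m])
    have la: "h l * a = of_int (\<theta> l) *s a" if "l < m" for l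
      using that by (simp add: a_def comm l scale_mult_right)
    have lb: "h l * b = of_int (\<theta> l) *s b" if "l < m" for l
      using that by (simp add: b_def comm la scale_mult_right)
    have step: ?case if x: "x \<in> W" "x \<noteq> 0" "h m * x = of_int c *s x" "\<And>l. l < m \<Longrightarrow> h l * x = of_int (\<theta> l) *s x" for x c
      using x by (intro bexI[of _ x] conjI exI[of _ "\<theta>(m := c)"]) (auto simp: less_Suc_eq)
    show ?case
    proof (cases "w - b = 0")
      case False
      show ?thesis
        by (rule step[of "w - b" 0])
          (use False W w ab l lb hb in \<open>auto simp: spmod_diff right_diff_distrib scale_right_diff_distrib a_def[symmetric]\<close>)
    next
      case wb: True
      show ?thesis
      proof (cases "b + a = 0")
        case False
        show ?thesis
          by (rule step[of "b + a" 1])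
            (use False W ab la lb hb in \<open>auto simp: spmod_def distrib_left scale_right_distrib b_def[symmetric]\<close>)
      next
        case ba: True
        have "b - a \<noteq> 0"
        proof
          assume "b - a = 0"
          then have "b = - b" using ba by (simp add: add_eq_0_iff)
          then show False using double_eq_zero[of b] wb w by simp
        qed
        then show ?thesis
          by (intro step[of "b - a" "-1"])
            (use W ab la lb hb in \<open>auto simp: spmod_diff right_diff_distrib scale_right_diff_distrib b_def[symmetric]\<close>)
      qed
    qed
  qed
  from this[of L] show ?thesis by (auto simp: wt_def)
qed

lemma wt_range:
  assumes "wt \<theta> v" "v \<noteq> 0" "l < L"
  shows "\<theta> l \<in> {-1, 0, 1}"
proof -
  let ?c = "of_int (\<theta> l) :: complex"
  have "h l * v = ?c *s v" using assms by (simp add: wt_def)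
  then have "h l * (h l * (h l * v)) = (?c * (?c * ?c)) *s v"
    by (simp add: scale_mult_right mult.assoc)
  moreover have "h l * (h l * (h l * v)) = h l * (h l * h l) * v" by (simp only: mult.assoc)
  then have "h l * (h l * (h l * v)) = ?c *s v" by (simp only: h_cube[OF assms(3)] \<open>h l * v = ?c *s v\<close>)
  ultimately have "?c * (?c * ?c) = ?c" using assms(2) by (metis scale_right_imp_eq)
  then have "\<theta> l * (\<theta> l * \<theta> l) = \<theta> l" by (metis of_int_eq_iff of_int_mult)
  then have "\<theta> l * (\<theta> l - 1) * (\<theta> l + 1) = 0" by (simp add: algebra_simps)
  then show ?thesis by auto
qed

lemma wt_sp_elt:
  assumes "wt \<theta> v" "i < 2*L" "k < 2*L"
  shows "wt (\<lambda>l. \<theta> l + eps l i + eps l k) (sp_elt i k * v)"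
  unfolding wt_def
proof (intro allI impI)
  fix l assume l: "l < L"
  have "h l * (sp_elt i k * v) = sp_elt i k * (h l * v) + of_int (eps l i + eps l k) *s (sp_elt i k * v)"
    unfolding mult.assoc[symmetric] h_sp_elt[OF l assms(2,3)] by (simp only: distrib_right scale_mult_left)
  also have "\<dots> = of_int (\<theta> l + eps l i + eps l k) *s (sp_elt i k * v)"
    using assms(1) l by (simp add: wt_def scale_mult_right scale_left_distrib algebra_simps)
  finally show "h l * (sp_elt i k * v) = of_int (\<theta> l + eps l i + eps l k) *s (sp_elt i k * v)" .
qed

text \<open>The weight of basis vector \<open>i\<close> under the functional that pairs a weight
  with \<open>(L, L - 1, ..., 1)\<close>, half the sum of the positive roots of sp. It takes a
  positive value on every positive root.\<close>

definition cost :: "nat \<Rightarrow> int" where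
  "cost i = (if i < L then int L - int i else int i - 2 * int L)"

lemma sum_eps: "i < 2*L \<Longrightarrow> (\<Sum>l<L. (int L - int l) * eps l i) = cost i"
proof -
  assume i: "i < 2*L"
  have "(\<Sum>l<L. (int L - int l) * eps l i) =
    (\<Sum>l<L. (if l = i then int L - int l else 0) - (if l + L = i then int L - int l else 0))"
    by (intro sum.cong refl) (auto simp: eps_def)
  also have "\<dots> = (\<Sum>l<L. if l = i then int L - int l else 0) - (\<Sum>l<L. if l + L = i then int L - int l else 0)"
    by (rule sum_subtractf)
  also have "(\<Sum>l<L. if l + L = i then int L - int l else 0) = (\<Sum>l<L. if l = i - L then (if L \<le> i then int L - int l else 0) else 0)"
    by (intro sum.cong) auto
  finally show ?thesis using i by (auto simp: cost_def)
qed

text \<open>Root vectors for twice the \<open>i\<close>-th unit weight and its negative; the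
  commutator is a multiple of the coroot. The factor -4 arises because both diagonal elements are
  doubled products, one of them with a sign.\<close>

lemma bracket_long:
  assumes "i < L"
  shows "sp_elt i i * sp_elt (i + L) (i + L) - sp_elt (i + L) (i + L) * sp_elt i i = -4 *s h i"
proof -
  have e: "sp_elt i i = -2 *s (p i * q (i + L))" "sp_elt (i + L) (i + L) = 2 *s (p (i + L) * q i)"
    using assms scale_left_distrib[of 1 1 "p i * q (i + L)"] scale_left_distrib[of 1 1 "p (i + L) * q i"]
    by (simp_all add: sp_elt_def chi_def bar_def sg_def)
  let ?E = "p i * q (i + L)" and ?F = "p (i + L) * q i"
  have "sp_elt i i * sp_elt (i + L) (i + L) - sp_elt (i + L) (i + L) * sp_elt i i = -4 *s (?E * ?F - ?F * ?E)"
    by (simp add: e scale_mult_left scale_mult_right scale_right_diff_distrib)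
  also have "?E * ?F - ?F * ?E = h i"
    using assms by (subst bracket_pq) (auto simp: h_def num_def)
  finally show ?thesis .
qed

lemma bracket_short:
  assumes "i < L" "k < L" "i \<noteq> k"
  shows "sp_elt i (k + L) * sp_elt k (i + L) - sp_elt k (i + L) * sp_elt i (k + L) = h i - h k"
proof -
  have e: "sp_elt i (k + L) = p i * q k - p (k + L) * q (i + L)"
    "sp_elt k (i + L) = p k * q i - p (i + L) * q (k + L)"
    using assms by (simp_all add: sp_elt_def chi_def bar_def sg_def)
  have expand: "(a - b) * (c - d) - (c - d) * (a - b) =
      (a * c - c * a) - (a * d - d * a) - (b * c - c * b) + (b * d - d * b)" for a b c d :: 'a
    by (simp add: left_diff_distrib right_diff_distrib)
  have less: "i < 2*L" "k < 2*L" "i + L < 2*L" "k + L < 2*L" using assms by auto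
  have neq: "k \<noteq> i + L" "i + L \<noteq> k" "i \<noteq> k + L" "k + L \<noteq> i" using assms by auto
  show ?thesis
    unfolding e expand bracket_pq[OF less(1,2,2,1)] bracket_pq[OF less(1,2,3,4)]
      bracket_pq[OF less(4,3,2,1)] bracket_pq[OF less(4,3,3,4)]
    using assms(3) neq by (simp add: h_def num_def)
qed

text \<open>A nonzero weight vector of \<open>W\<close> whose weight maximises a functional that is positive on the
  positive roots is killed by all positive root vectors. Its weight has entries in \<open>{-1, 0, 1}\<close>, and
  the \<open>sl\<^sub>2\<close>-triples of the simple roots force this weight to be dominant, hence of the form
  \<open>(1, \<dots>, 1, 0, \<dots>, 0)\<close>.\<close>

lemma highest_weight:
  assumes W: "spmod W" and ne: "w \<in> W" "w \<noteq> 0"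
  shows "\<exists>v\<in>W. v \<noteq> 0 \<and> (\<exists>k\<le>L. (\<forall>l<L. h l * v = (if l < k then 1 else 0) *s v) \<and>
    (\<forall>i<2*L. \<forall>j<2*L. cost i + cost j > 0 \<longrightarrow> sp_elt i j * v = 0))"
proof -
  define F where "F \<theta> = (\<Sum>l<L. (int L - int l) * \<theta> l)" for \<theta> :: "nat \<Rightarrow> int"
  define B where "B = (\<Sum>l<L. int L - int l)"
  define P where "P x \<longleftrightarrow> fst x \<in> W \<and> fst x \<noteq> 0 \<and> wt (snd x) (fst x)" for x
  have F_le: "F \<theta> \<le> B" if "wt \<theta> v" "v \<noteq> 0" for \<theta> v
    unfolding F_def B_def
  proof (rule sum_mono)
    fix l assume "l \<in> {..<L}"
    then show "(int L - int l) * \<theta> l \<le> int L - int l" using wt_range[OF that, of l] by auto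
  qed
  obtain x0 where "P x0" using exists_wt[OF W ne] by (auto simp: P_def)
  \<comment> \<open>The maximum of \<open>F\<close> is found as a minimum over the naturals. By
    \<open>F_le\<close> the difference \<open>B - F\<close> is nonnegative on weight vectors, so the
    truncation in \<open>nat\<close> loses nothing.\<close>
  then obtain x where x: "P x" and min: "\<And>y. P y \<Longrightarrow> nat (B - F (snd x)) \<le> nat (B - F (snd y))"
    using ex_has_least_nat[of P x0 "\<lambda>x. nat (B - F (snd x))"] by auto
  obtain v \<theta> where [simp]: "x = (v, \<theta>)" by force
  have v: "v \<in> W" "v \<noteq> 0" "wt \<theta> v" using x by (auto simp: P_def)
  have max: "F \<theta>' \<le> F \<theta>" if "v' \<in> W" "v' \<noteq> 0" "wt \<theta>' v'" for v' \<theta>'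
    using min[of "(v', \<theta>')"] that F_le[of \<theta>' v'] F_le[OF v(3,2)] by (auto simp: P_def)
  have kill: "sp_elt i j * v = 0" if "i < 2*L" "j < 2*L" "cost i + cost j > 0" for i j
  proof (rule ccontr)
    assume nz: "sp_elt i j * v \<noteq> 0"
    have "F (\<lambda>l. \<theta> l + eps l i + eps l j) = F \<theta> + cost i + cost j"
      using that by (simp add: F_def sum_eps[symmetric] distrib_left sum.distrib)
    moreover have "F (\<lambda>l. \<theta> l + eps l i + eps l j) \<le> F \<theta>"
      using W v that nz by (intro max[of "sp_elt i j * v"] wt_sp_elt) (auto simp: spmod_def)
    ultimately show False using that by simp
  qed
  have hv: "h l * v = of_int (\<theta> l) *s v" if "l < L" for l using v(3) that by (simp add: wt_def)
  have range: "\<theta> l \<in> {-1, 0, 1}" if "l < L" for l using wt_range[OF v(3,2) that] .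
  \<comment> \<open>From the value -1 the lowering root vector would lead to -3, outside the range,
    so it kills \<open>v\<close>. The raising one kills \<open>v\<close> by maximality. Hence so
    does their commutator, a multiple of \<open>h i\<close>, although \<open>h i\<close> acts as
    -1.\<close>
  have nonneg: "\<theta> i \<ge> 0" if i: "i < L" for i
  proof (rule ccontr)
    assume "\<not> \<theta> i \<ge> 0"
    then have \<theta>: "\<theta> i = -1" using range[OF i] by auto
    have "wt (\<lambda>l. \<theta> l + eps l (i + L) + eps l (i + L)) (sp_elt (i + L) (i + L) * v)"
      using i v by (intro wt_sp_elt) auto
    from wt_range[OF this _ i] have "sp_elt (i + L) (i + L) * v = 0"
      using \<theta> i by (auto simp: eps_def)
    moreover have "sp_elt i i * v = 0" using i by (intro kill) (auto simp: cost_def)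
    ultimately have "(-4 *s h i) * v = 0"
      unfolding bracket_long[OF i, symmetric] by (simp add: left_diff_distrib mult.assoc)
    then show False using v(2) hv[OF i] \<theta> by (simp add: scale_mult_left)
  qed
  \<comment> \<open>The same argument for the short roots. The lowering vector adds 1 to
    \<open>\<theta> k\<close> and subtracts 1 from \<open>\<theta> i\<close>; if
    \<open>\<theta> i < \<theta> k\<close>, one of the two leaves {-1, 0, 1}.\<close>
  have decr: "\<theta> k \<le> \<theta> i" if ik: "i < k" "k < L" for i k
  proof (rule ccontr)
    assume less: "\<not> \<theta> k \<le> \<theta> i"
    have i: "i < L" using ik by simp
    have "wt (\<lambda>l. \<theta> l + eps l k + eps l (i + L)) (sp_elt k (i + L) * v)"
      using ik v by (intro wt_sp_elt) auto
    note r = wt_range[OF this _ i] wt_range[OF this _ ik(2)]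
    have "sp_elt k (i + L) * v = 0"
    proof (rule ccontr)
      assume "sp_elt k (i + L) * v \<noteq> 0"
      then show False using r range[OF i] range[OF ik(2)] less ik by (auto simp: eps_def)
    qed
    moreover have "sp_elt i (k + L) * v = 0" using ik by (intro kill) (auto simp: cost_def)
    ultimately have "(h i - h k) * v = 0"
      unfolding bracket_short[OF i ik(2) less_imp_neq[OF ik(1)], symmetric]
      by (simp add: left_diff_distrib mult.assoc)
    then have "of_int (\<theta> i - \<theta> k) *s v = 0"
      using hv[OF i] hv[OF ik(2)] by (simp add: left_diff_distrib scale_left_diff_distrib)
    then show False using v(2) less by simp
  qed
  define k where "k = card {l. l < L \<and> \<theta> l = 1}"
  have down: "l' \<in> {l. l < L \<and> \<theta> l = 1}" if "l \<in> {l. l < L \<and> \<theta> l = 1}" "l' < l" for l l'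
    using that decr[of l' l] range[of l'] by auto
  \<comment> \<open>A finite set of naturals that is closed downwards is an initial segment, so its
    cardinality is its bound.\<close>
  have "{l. l < L \<and> \<theta> l = 1} = {..<k}"
  proof -
    define S where "S = {l. l < L \<and> \<theta> l = 1}"
    have fin: "finite S" by (simp add: S_def)
    have "l < card S" if "l \<in> S" for l
    proof -
      have "{..l} \<subseteq> S"
      proof
        fix l' assume "l' \<in> {..l}"
        then show "l' \<in> S" using down[of l l'] that by (cases "l' = l") (auto simp: S_def)
      qed
      from card_mono[OF fin this] show ?thesis by simp
    qed
    then have "S \<subseteq> {..<card S}" by auto
    then have "S = {..<card S}" by (intro card_subset_eq) auto
    then show ?thesis by (simp add: S_def k_def)
  qed
  then have set_eq: "l < L \<and> \<theta> l = 1 \<longleftrightarrow> l < k" for l by blast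
  have \<theta>: "\<theta> l = (if l < k then 1 else 0)" if "l < L" for l
    using that range[OF that] nonneg[OF that] set_eq[of l] by auto
  have k: "k \<le> L" using card_mono[of "{..<L}" "{l. l < L \<and> \<theta> l = 1}"] by (auto simp: k_def)
  have "\<forall>l<L. h l * v = (if l < k then 1 else 0) *s v"
  proof (intro allI impI)
    fix l assume l: "l < L"
    show "h l * v = (if l < k then 1 else 0) *s v" unfolding hv[OF l] \<theta>[OF l] by simp
  qed
  moreover have "\<forall>i<2*L. \<forall>j<2*L. cost i + cost j > 0 \<longrightarrow> sp_elt i j * v = 0"
    by (intro allI impI) (rule kill)
  ultimately show ?thesis using v(1,2) k by blast
qed

section \<open>Comparison with the matrix forms of the nilpotent and Cartan subalgebras\<close>

lemma rho_nplus_kill: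
  assumes X: "X \<in> sp_nplus L"
    and kill: "\<And>i j. i < 2*L \<Longrightarrow> j < 2*L \<Longrightarrow> cost i + cost j > 0 \<Longrightarrow> sp_elt i j * v = 0"
  shows "rho X * v = 0"
proof -
  let ?S = "\<lambda>i k. - sg k * X $$ (i, bar k)"
  have sp: "X \<in> sp_alg L" using X by (simp add: sp_nplus_def)
  have X1: "X $$ (i, k) = 0" if "i < 2*L" "k < L" "L \<le> i \<or> k \<le> i" for i k
    using X that by (cases "L \<le> i") (auto simp: sp_nplus_def not_le)
  \<comment> \<open>For \<open>k \<ge> L\<close> the entry lies in one of the first \<open>L\<close>
    columns, and nonpositive total cost says precisely that it is in the lower left block or on or
    below the diagonal of the upper left block, where \<open>sp_nplus\<close> prescribes zeros. For
    \<open>k < L\<close> nonpositive cost forces \<open>i \<ge> L\<close>, and the symmetry of the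
    coefficients reduces to this case.\<close>
  have S0: "?S i k = 0" if "i < 2*L" "k < 2*L" "k \<ge> L" "cost i + cost k \<le> 0" for i k
    using that X1[of i "k - L"] by (auto simp: cost_def bar_def split: if_splits)
  have S: "?S i k = 0" if "i < 2*L" "k < 2*L" "cost i + cost k \<le> 0" for i k
  proof (cases "k \<ge> L")
    case False
    then have "i \<ge> L" using that by (auto simp: cost_def split: if_splits)
    then show ?thesis using S0[of k i] that rho_quad(2)[OF sp that(1,2)] by simp
  qed (use S0 that in auto)
  have rho: "rho X = (1/2) *s (\<Sum>i<2*L. \<Sum>k<2*L. ?S i k *s sp_elt i k)"
    unfolding rho_quad(1)[OF sp] by (rule quad_sym) (rule rho_quad(2)[OF sp])
  have "rho X * v = (1/2) *s (\<Sum>i<2*L. \<Sum>k<2*L. ?S i k *s (sp_elt i k * v))"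
    by (simp only: rho scale_mult_left sum_distrib_right)
  also have "(\<Sum>i<2*L. \<Sum>k<2*L. ?S i k *s (sp_elt i k * v)) = 0"
  proof (intro sum.neutral ballI)
    fix i k assume ik: "i \<in> {..<2*L}" "k \<in> {..<2*L}"
    show "?S i k *s (sp_elt i k * v) = 0"
    proof (cases "cost i + cost k > 0")
      case True
      then have "sp_elt i k * v = 0" using ik by (intro kill) auto
      then show ?thesis by (simp only: scale_zero_right)
    next
      case False
      then have "?S i k = 0" using ik by (intro S) auto
      then show ?thesis by (simp only: scale_zero_left)
    qed
  qed
  finally show ?thesis by simp
qed

lemma rho_cartan:
  assumes H: "H \<in> sp_cartan L"
  shows "rho H = (\<Sum>l<L. H $$ (l, l) *s h l)"
proof -
  have sp: "H \<in> sp_alg L" and off: "\<And>i k. i < 2*L \<Longrightarrow> k < 2*L \<Longrightarrow> i \<noteq> k \<Longrightarrow> H $$ (i, k) = 0"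
    using H by (auto simp: sp_cartan_def)
  have neg: "H $$ (l + L, l + L) = - H $$ (l, l)" if "l < L" for l
  proof -
    have "sg (l + L) * H $$ (l, bar (l + L)) = sg l * H $$ (l + L, bar l)"
      using sp that unfolding sp_alg_iff by simp
    then show ?thesis using that by (simp add: sg_def bar_def)
  qed
  have "rho H = (\<Sum>i<2*L. \<Sum>k<2*L. if k = i then H $$ (i, i) *s num i else 0)"
    unfolding rho_def bil_def by (intro sum.cong refl) (auto simp: off num_def)
  also have "\<dots> = (\<Sum>i<2*L. H $$ (i, i) *s num i)" by simp
  also have "\<dots> = (\<Sum>i\<in>{..<L} \<union> {L..<2*L}. H $$ (i, i) *s num i)"
    by (rule sum.cong) auto
  also have "\<dots> = (\<Sum>i<L. H $$ (i, i) *s num i) + (\<Sum>i\<in>{L..<2*L}. H $$ (i, i) *s num i)"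
    by (rule sum.union_disjoint) auto
  also have "(\<Sum>i\<in>{L..<2*L}. H $$ (i, i) *s num i) = (\<Sum>l<L. H $$ (l + L, l + L) *s num (l + L))"
    using sum.shift_bounds_nat_ivl[of "\<lambda>i. H $$ (i, i) *s num i" 0 L L] by (simp add: lessThan_atLeast0 mult_2)
  finally show ?thesis
    by (simp add: neg h_def scale_right_diff_distrib sum_subtractf sum_negf)
qed

lemma rho_cartan_highest:
  assumes H: "H \<in> sp_cartan L" and k: "k \<le> L"
    and v: "\<And>l. l < L \<Longrightarrow> h l * v = (if l < k then 1 else 0) *s v"
  shows "rho H * v = (\<Sum>i<k. H $$ (i, i)) *s v"
proof -
  have filter: "{l \<in> {..<L}. l < k} = {..<k}" using k by auto
  have "rho H * v = (\<Sum>l<L. H $$ (l, l) *s (h l * v))"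
    unfolding rho_cartan[OF H] sum_distrib_right by (simp only: scale_mult_left)
  also have "\<dots> = (\<Sum>l<L. if l < k then H $$ (l, l) *s v else 0)"
    by (rule sum.cong[OF refl]) (simp add: v)
  also have "\<dots> = (\<Sum>l<k. H $$ (l, l) *s v)"
    unfolding filter[symmetric] by (rule sum.inter_filter[symmetric]) simp
  finally show ?thesis by (simp only: scale_sum_left)
qed

section \<open>Invertible elements that scale the modes under conjugation\<close>

definition conjugates :: "'a \<Rightarrow> 'a \<Rightarrow> (nat \<Rightarrow> complex) \<Rightarrow> bool" where
  "conjugates D D' \<mu> \<longleftrightarrow> D * D' = 1 \<and> D' * D = 1 \<and>
    (\<forall>i<2*L. D * p i = \<mu> i *s (p i * D) \<and> q i * D = \<mu> i *s (D * q i))"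

lemma conjugates_mult:
  assumes D: "conjugates D D' \<mu>" and E: "conjugates E E' \<nu>"
  shows "conjugates (D * E) (E' * D') (\<lambda>i. \<mu> i * \<nu> i)"
proof -
  have "D * E * (E' * D') = D * (E * E') * D'" "E' * D' * (D * E) = E' * (D' * D) * E"
    by (simp_all add: mult.assoc)
  then have inv: "D * E * (E' * D') = 1" "E' * D' * (D * E) = 1"
    using D E by (simp_all add: conjugates_def)
  have "D * E * p i = (\<mu> i * \<nu> i) *s (p i * (D * E))" if "i < 2*L" for i
  proof -
    have "D * E * p i = D * (E * p i)" by (simp only: mult.assoc)
    also have "E * p i = \<nu> i *s (p i * E)" using E that by (simp add: conjugates_def)
    also have "D * (\<nu> i *s (p i * E)) = \<nu> i *s (D * p i * E)"
      by (simp only: scale_mult_right mult.assoc)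
    also have "D * p i = \<mu> i *s (p i * D)" using D that by (simp add: conjugates_def)
    finally show ?thesis by (simp add: scale_mult_left mult.assoc mult.commute)
  qed
  moreover have "q i * (D * E) = (\<mu> i * \<nu> i) *s (D * E * q i)" if "i < 2*L" for i
  proof -
    have "q i * (D * E) = q i * D * E" by (simp only: mult.assoc)
    also have "q i * D = \<mu> i *s (D * q i)" using D that by (simp add: conjugates_def)
    also have "\<mu> i *s (D * q i) * E = \<mu> i *s (D * (q i * E))"
      by (simp only: scale_mult_left mult.assoc)
    also have "q i * E = \<nu> i *s (E * q i)" using E that by (simp add: conjugates_def)
    finally show ?thesis by (simp add: scale_mult_right mult.assoc)
  qed
  ultimately show ?thesis using inv by (simp add: conjugates_def)
qed

text \<open>This is \<open>\<mu>\<close> to the power \<open>num k\<close>: as \<open>num k\<close>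
  is idempotent, it acts as \<open>\<mu>\<close> where mode \<open>k\<close> is occupied and as 1
  where it is empty.\<close>

definition rot :: "complex \<Rightarrow> nat \<Rightarrow> 'a" where
  "rot \<mu> k = 1 + (\<mu> - 1) *s num k"

lemma rot_mult: "k < 2*L \<Longrightarrow> rot \<mu> k * rot \<nu> k = rot (\<mu> * \<nu>) k"
  by (simp add: rot_def distrib_left distrib_right scale_mult_left scale_mult_right num_idem
      scale_left_distrib[symmetric] add.assoc) (simp add: algebra_simps)

lemma conjugates_rot:
  assumes "k < 2*L" "\<mu> \<noteq> 0"
  shows "conjugates (rot \<mu> k) (rot (1 / \<mu>) k) (\<lambda>i. if i = k then \<mu> else 1)"
proof -
  have "rot 1 k = 1" by (simp add: rot_def)
  moreover have "rot \<mu> k * p i = (if i = k then \<mu> else 1) *s (p i * rot \<mu> k)" if "i < 2*L" for i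
    using that assms num_p_other[of k i]
    by (cases "i = k") (auto simp: rot_def distrib_left distrib_right scale_mult_left scale_mult_right
        num_p p_num scale_left_diff_distrib left_diff_distrib right_diff_distrib)
  moreover have "q i * rot \<mu> k = (if i = k then \<mu> else 1) *s (rot \<mu> k * q i)" if "i < 2*L" for i
    using that assms num_q_other[of k i]
    by (cases "i = k") (auto simp: rot_def distrib_left distrib_right scale_mult_left scale_mult_right
        q_num num_q scale_left_diff_distrib left_diff_distrib right_diff_distrib)
  ultimately show ?thesis using assms by (simp add: conjugates_def rot_mult)
qed

text \<open>With reciprocal parameters at \<open>l\<close> and \<open>l + L\<close> the pair acts as
  1 when both modes are empty and also when both are occupied, the two states that
  \<open>h l\<close> does not tell apart. So it is the quadratic polynomial in \<open>h l\<close>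
  with the values \<open>\<mu>\<close>, 1, \<open>1 / \<mu>\<close> at 1, 0, -1; the coefficients
  come from this interpolation.\<close>

lemma rot_pair_in_subalg:
  assumes A: "subalg A" and h: "h l \<in> A" and l: "l < L" and \<mu>: "\<mu> \<noteq> 0"
  shows "rot \<mu> l * rot (1 / \<mu>) (l + L) \<in> A"
proof -
  let ?n = "num l" and ?m = "num (l + L)"
  have c: "(1 / \<mu> - 1) * (\<mu> - 1) = 2 - \<mu> - 1 / \<mu>" using \<mu> by (simp add: field_simps)
  have "rot \<mu> l * rot (1 / \<mu>) (l + L) =
      1 + (\<mu> - 1) *s ?n + (1 / \<mu> - 1) *s ?m + (2 - \<mu> - 1 / \<mu>) *s (?n * ?m)"
    by (simp add: rot_def distrib_left distrib_right scale_mult_left scale_mult_right scale_right_distrib c add_ac)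
  also have "\<dots> = 1 + ((\<mu> - 1 / \<mu>) / 2) *s h l + ((\<mu> + 1 / \<mu>) / 2 - 1) *s (h l * h l)"
  proof -
    have two: "?n * ?m + ?n * ?m = 2 *s (?n * ?m)"
      using scale_left_distrib[of 1 1 "?n * ?m"] by simp
    have "((\<mu> - 1 / \<mu>) / 2) *s h l + ((\<mu> + 1 / \<mu>) / 2 - 1) *s (h l * h l) =
      ((\<mu> - 1 / \<mu>) / 2 + ((\<mu> + 1 / \<mu>) / 2 - 1)) *s ?n + (- ((\<mu> - 1 / \<mu>) / 2) + ((\<mu> + 1 / \<mu>) / 2 - 1)) *s ?m
      - (((\<mu> + 1 / \<mu>) / 2 - 1) * 2) *s (?n * ?m)"
      unfolding h_square[OF l] unfolding h_def[of l] two
      by (simp only: scale_left_distrib scale_right_distrib scale_right_diff_distrib scale_scale scale_minus_left)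
        (simp add: algebra_simps)
    also have "(\<mu> - 1 / \<mu>) / 2 + ((\<mu> + 1 / \<mu>) / 2 - 1) = \<mu> - 1" by (simp add: field_simps)
    also have "- ((\<mu> - 1 / \<mu>) / 2) + ((\<mu> + 1 / \<mu>) / 2 - 1) = 1 / \<mu> - 1" by (simp add: field_simps)
    also have "((\<mu> + 1 / \<mu>) / 2 - 1) * 2 = - (2 - \<mu> - 1 / \<mu>)" by (simp add: field_simps)
    finally show ?thesis by (simp only: scale_minus_left diff_minus_eq_add add.assoc)
  qed
  finally show ?thesis using A h
    by (simp add: subalg_add subalg_mult subalg_one subalg_scale)
qed

lemma torus_in_subalg:
  assumes A: "subalg A" and h: "\<And>l. l < L \<Longrightarrow> h l \<in> A"
    and \<mu>: "\<And>l. l < L \<Longrightarrow> \<mu> l \<noteq> 0" "\<And>l. l < L \<Longrightarrow> \<mu> (l + L) = 1 / \<mu> l"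
  obtains D D' where "D \<in> A" "D' \<in> A" "conjugates D D' \<mu>"
proof -
  have "m \<le> L \<Longrightarrow> \<exists>D\<in>A. \<exists>D'\<in>A. conjugates D D' (\<lambda>i. if i < m \<or> L \<le> i \<and> i < L + m then \<mu> i else 1)" for m
  proof (induction m)
    case 0
    have "(\<lambda>i. if i < 0 \<or> L \<le> i \<and> i < L + 0 then \<mu> i else 1) = (\<lambda>i. 1)"
      by (auto simp: fun_eq_iff)
    then show ?case using subalg_one[OF A] by (intro bexI[of _ 1]) (simp_all add: conjugates_def)
  next
    case (Suc m)
    then obtain D D' where D: "D \<in> A" "D' \<in> A"
      "conjugates D D' (\<lambda>i. if i < m \<or> L \<le> i \<and> i < L + m then \<mu> i else 1)" by auto
    have m: "m < L" "m < 2*L" "m + L < 2*L" and nz: "\<mu> m \<noteq> 0" using Suc.prems \<mu> by auto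
    let ?E = "rot (\<mu> m) m * rot (1 / \<mu> m) (m + L)"
    \<comment> \<open>The inverse of a product comes out in reversed order. Number operators
      commute, so it can be put into the order that \<open>rot_pair_in_subalg\<close> accepts, with
      parameter \<open>1 / \<mu> m\<close>.\<close>
    have E': "rot (1 / (1 / \<mu> m)) (m + L) * rot (1 / \<mu> m) m = rot (1 / \<mu> m) m * rot (1 / (1 / \<mu> m)) (m + L)"
      using num_commute[OF m(2,3)]
      by (simp add: rot_def distrib_left distrib_right scale_mult_left scale_mult_right scale_right_distrib
          add_ac mult.commute[of "1 / _ - 1"])
    have "conjugates ?E (rot (1 / \<mu> m) m * rot (1 / (1 / \<mu> m)) (m + L))
      (\<lambda>i. (if i = m then \<mu> m else 1) * (if i = m + L then 1 / \<mu> m else 1))"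
      unfolding E'[symmetric] using m nz by (intro conjugates_mult conjugates_rot) auto
    from conjugates_mult[OF D(3) this]
    have "conjugates (D * ?E) (rot (1 / \<mu> m) m * rot (1 / (1 / \<mu> m)) (m + L) * D')
      (\<lambda>i. if i < Suc m \<or> L \<le> i \<and> i < L + Suc m then \<mu> i else 1)"
      by (rule back_subst[of "\<lambda>f. conjugates _ _ f"]) (use m \<mu>(2)[of m] in \<open>auto simp: fun_eq_iff add.commute\<close>)
    moreover have "D * ?E \<in> A" "rot (1 / \<mu> m) m * rot (1 / (1 / \<mu> m)) (m + L) * D' \<in> A"
      using subalg_mult[OF A D(1) rot_pair_in_subalg[OF A h[OF m(1)] m(1) nz]]
        subalg_mult[OF A rot_pair_in_subalg[OF A h[OF m(1)] m(1), of "1 / \<mu> m"] D(2)] nz by simp_all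
    ultimately show ?case by blast
  qed
  from this[of L] obtain D D' where D: "D \<in> A" "D' \<in> A"
    "conjugates D D' (\<lambda>i. if i < L \<or> L \<le> i \<and> i < L + L then \<mu> i else 1)" by auto
  then have "conjugates D D' \<mu>" by (auto simp: conjugates_def mult_2)
  with D that show ?thesis by blast
qed

end

subsection \<open>Generation by neighbouring products, and Fourier modes\<close>

context calg
begin

lemma anticommutator_sums:
  assumes "finite I" "finite K" "\<And>i k. i \<in> I \<Longrightarrow> k \<in> K \<Longrightarrow> x i * y k + y k * x i = e i k *s 1"
  shows "(\<Sum>i\<in>I. s i *s x i) * (\<Sum>k\<in>K. t k *s y k) + (\<Sum>k\<in>K. t k *s y k) * (\<Sum>i\<in>I. s i *s x i) =
    (\<Sum>i\<in>I. \<Sum>k\<in>K. s i * t k * e i k) *s 1"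
proof -
  have "(\<Sum>k\<in>K. t k *s y k) * (\<Sum>i\<in>I. s i *s x i) = (\<Sum>i\<in>I. \<Sum>k\<in>K. (s i * t k) *s (y k * x i))"
    unfolding mult_sum_scale by (subst sum.swap) (simp add: mult.commute)
  then have "(\<Sum>i\<in>I. s i *s x i) * (\<Sum>k\<in>K. t k *s y k) + (\<Sum>k\<in>K. t k *s y k) * (\<Sum>i\<in>I. s i *s x i) =
    (\<Sum>i\<in>I. \<Sum>k\<in>K. (s i * t k) *s (x i * y k + y k * x i))"
    unfolding mult_sum_scale by (simp add: scale_right_distrib sum.distrib)
  also have "\<dots> = (\<Sum>i\<in>I. \<Sum>k\<in>K. (s i * t k * e i k) *s 1)"
    by (intro sum.cong refl) (simp add: assms(3))
  finally show ?thesis by (simp add: scale_sum_left)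
qed

lemma sum_change_basis:
  assumes y: "\<And>j. j \<in> J \<Longrightarrow> y j = (\<Sum>k\<in>K. R j k *s x k)" and i: "i \<in> K" and K: "finite K"
    and inv: "\<And>k. k \<in> K \<Longrightarrow> (\<Sum>j\<in>J. Q j * R j k) = (if k = i then 1 else 0)"
  shows "x i = (\<Sum>j\<in>J. Q j *s y j)"
proof -
  have "(\<Sum>j\<in>J. Q j *s y j) = (\<Sum>j\<in>J. \<Sum>k\<in>K. (Q j * R j k) *s x k)"
    by (intro sum.cong refl) (simp add: y scale_sum_right)
  also have "\<dots> = (\<Sum>k\<in>K. (\<Sum>j\<in>J. Q j * R j k) *s x k)"
    by (subst sum.swap) (simp add: scale_sum_left)
  also have "\<dots> = (\<Sum>k\<in>K. if k = i then x k else 0)"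
    by (intro sum.cong refl) (simp add: inv)
  finally show ?thesis using i K by simp
qed

text \<open>The commutator of \<open>a j * b j\<close> with the symmetrised product \<open>a k * b l + a l * b k\<close> is a
  combination of the symmetrised products with indices \<open>(j, l)\<close> and \<open>(j, k)\<close>. Hence neighbouring
  indices can be moved apart, starting from the \<open>a j * b j\<close>.\<close>

lemma sym_products_in_subalg:
  assumes A: "subalg A"
    and aa: "\<And>j k. j \<in> {1..N} \<Longrightarrow> k \<in> {1..N} \<Longrightarrow> a j * a k = - (a k * a j)"
    and bb: "\<And>j k. j \<in> {1..N} \<Longrightarrow> k \<in> {1..N} \<Longrightarrow> b j * b k = - (b k * b j)"
    and ba: "\<And>j k. j \<in> {1..N} \<Longrightarrow> k \<in> {1..N} \<Longrightarrow> b j * a k = \<omega> k j *s 1 - a k * b j"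
    and antisym: "\<And>j k. \<omega> j k = - \<omega> k j"
    and neighbour: "\<And>j. 1 \<le> j \<Longrightarrow> j < N \<Longrightarrow> \<omega> (Suc j) j \<noteq> 0"
    and e: "\<And>j. j \<in> {1..N} \<Longrightarrow> a j * b j \<in> A"
    and jk: "j \<in> {1..N}" "k \<in> {1..N}"
  shows "a j * b k + a k * b j \<in> A"
proof -
  define P where "P j k = a j * b k + a k * b j" for j k
  have bracket: "a j * b j * (a k * b l) - a k * b l * (a j * b j) = \<omega> k j *s (a j * b l) - \<omega> j l *s (a k * b j)"
    if "j \<in> {1..N}" "k \<in> {1..N}" "l \<in> {1..N}" for j k l
  proof -
    have "a j * b j * (a k * b l) = a j * (b j * a k) * b l" by (simp only: mult.assoc)
    also have "\<dots> = \<omega> k j *s (a j * b l) - a j * a k * (b j * b l)"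
      unfolding ba[OF that(1,2)] by (simp add: left_diff_distrib right_diff_distrib scale_mult_left scale_mult_right mult.assoc)
    finally have 1: "a j * b j * (a k * b l) = \<omega> k j *s (a j * b l) - a j * a k * (b j * b l)" .
    have "a k * b l * (a j * b j) = a k * (b l * a j) * b j" by (simp only: mult.assoc)
    also have "\<dots> = \<omega> j l *s (a k * b j) - a k * a j * (b l * b j)"
      unfolding ba[OF that(3,1)] by (simp add: left_diff_distrib right_diff_distrib scale_mult_left scale_mult_right mult.assoc)
    also have "a k * a j * (b l * b j) = a j * a k * (b j * b l)"
      unfolding aa[OF that(2,1)] bb[OF that(3,1)] by simp
    finally show ?thesis using 1 by simp
  qed
  have P_bracket: "a j * b j * P k l - P k l * (a j * b j) = \<omega> k j *s P j l + \<omega> l j *s P j k"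
    if "j \<in> {1..N}" "k \<in> {1..N}" "l \<in> {1..N}" for j k l
  proof -
    have "a j * b j * P k l - P k l * (a j * b j) =
      (a j * b j * (a k * b l) - a k * b l * (a j * b j)) + (a j * b j * (a l * b k) - a l * b k * (a j * b j))"
      by (simp add: P_def distrib_left distrib_right)
    then show ?thesis
      unfolding bracket[OF that] bracket[OF that(1,3,2)] using antisym[of j l] antisym[of j k]
      by (simp add: P_def scale_right_distrib)
  qed
  have PA: "a j * b j * x - x * (a j * b j) \<in> A" if "x \<in> A" "j \<in> {1..N}" for x j
    using A e that by (simp add: subalg_diff subalg_mult)
  have diag: "P j j \<in> A" if "j \<in> {1..N}" for j
    using A e that by (simp add: P_def subalg_add)
  have succ: "P j (Suc j) \<in> A" if "1 \<le> j" "j < N" for j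
  proof -
    have "\<omega> (Suc j) j *s P j (Suc j) + \<omega> (Suc j) j *s P j (Suc j) \<in> A"
      using PA[OF diag[of "Suc j"], of j] P_bracket[of j "Suc j" "Suc j"] that by simp
    then have "(2 * \<omega> (Suc j) j) *s P j (Suc j) \<in> A"
      using scale_left_distrib[of 1 1 "\<omega> (Suc j) j *s P j (Suc j)"] by simp
    then show ?thesis using scale_cancel_subalg[OF A] neighbour that by simp
  qed
  \<comment> \<open>Induction on the distance. The bracket of \<open>a j * b j\<close> with the
    product for \<open>Suc j\<close> and \<open>j + Suc d\<close> contains the wanted product with a
    nonzero factor, plus a multiple of the neighbouring product \<open>P j (Suc j)\<close>, which
    \<open>succ\<close> provides. At distance 1 both terms coincide, hence the separate
    case.\<close>
  have P_up: "1 \<le> j \<Longrightarrow> j + d \<le> N \<Longrightarrow> P j (j + d) \<in> A" for j d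
  proof (induction d arbitrary: j)
    case 0
    then show ?case using diag by simp
  next
    case (Suc d)
    show ?case
    proof (cases "d = 0")
      case True
      then show ?thesis using succ Suc.prems by simp
    next
      case False
      have IH: "P (Suc j) (j + Suc d) \<in> A" using Suc.IH[of "Suc j"] Suc.prems by simp
      have "\<omega> (Suc j) j *s P j (j + Suc d) + \<omega> (j + Suc d) j *s P j (Suc j) \<in> A"
        using PA[OF IH, of j] P_bracket[of j "Suc j" "j + Suc d"] Suc.prems by simp
      moreover have "\<omega> (j + Suc d) j *s P j (Suc j) \<in> A"
        using succ[of j] Suc.prems A by (simp add: subalg_scale)
      ultimately have "\<omega> (Suc j) j *s P j (j + Suc d) \<in> A"
        using subalg_diff[OF A] by (metis add_diff_cancel_right')
      then show ?thesis using scale_cancel_subalg[OF A] neighbour[of j] Suc.prems by simp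
    qed
  qed
  have "P j k \<in> A"
  proof (cases "j \<le> k")
    case True
    then show ?thesis using P_up[of j "k - j"] jk by simp
  next
    case False
    then have "P k j \<in> A" using P_up[of k "j - k"] jk by simp
    then show ?thesis by (simp add: P_def add.commute)
  qed
  then show ?thesis by (simp add: P_def)
qed

section \<open>Translation of antiperiodic Fourier sums\<close>

definition antiper :: "nat \<Rightarrow> (nat \<Rightarrow> 'a) \<Rightarrow> nat \<Rightarrow> 'a" where
  "antiper N x j = (if j \<le> N then x j else - x (j - N))"

text \<open>The factor \<open>1 / \<zeta> ^ j\<close> and the continued sequence both change sign
  after \<open>N\<close> steps, so the summand is periodic and the sum over any window of length
  \<open>N\<close> is the same.\<close>

lemma antiper_fourier:
  assumes N: "N \<ge> 2" and \<zeta>: "\<zeta> ^ N = -1"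
  shows "(\<Sum>j=1..N. (1 / \<zeta> ^ j) *s antiper N x (j + 2)) = \<zeta>\<^sup>2 *s (\<Sum>j=1..N. (1 / \<zeta> ^ j) *s x j)"
proof -
  define G where "G j = (1 / \<zeta> ^ j) *s antiper N x j" for j
  have \<zeta>0: "\<zeta> \<noteq> 0" using \<zeta> N by (auto simp: power_0_left)
  have per: "G (N + j) = G j" if "1 \<le> j" "j \<le> N" for j
    using that by (simp add: G_def antiper_def power_add \<zeta>)
  have shift: "(\<Sum>j=1..N. G (m + Suc j)) = (\<Sum>j=1..N. G (m + j))" if "m < N" for m
  proof -
    have "(\<Sum>j=1..N. G (m + Suc j)) + G (m + 1) = (\<Sum>j=1..Suc N. G (m + j))"
      using sum.atLeast_Suc_atMost_Suc_shift[of "\<lambda>j. G (m + j)" 1 N]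
        sum.atLeast_Suc_atMost[of 1 "Suc N" "\<lambda>j. G (m + j)"] by simp
    also have "\<dots> = (\<Sum>j=1..N. G (m + j)) + G (N + (m + 1))"
      by (simp add: add_ac)
    finally show ?thesis using per[of "m + 1"] that by simp
  qed
  have "(\<Sum>j=1..N. (1 / \<zeta> ^ j) *s antiper N x (j + 2)) = \<zeta>\<^sup>2 *s (\<Sum>j=1..N. G (1 + Suc j))"
    unfolding scale_sum_right
    by (intro sum.cong refl) (simp add: G_def \<zeta>0 power2_eq_square)
  also have "(\<Sum>j=1..N. G (1 + Suc j)) = (\<Sum>j=1..N. G j)"
    using shift[of 1] shift[of 0] N by simp
  also have "\<dots> = (\<Sum>j=1..N. (1 / \<zeta> ^ j) *s x j)"
    by (intro sum.cong refl) (simp add: G_def antiper_def)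
  finally show ?thesis .
qed

end

text \<open>The solutions of \<open>z ^ (2*L) = -1\<close>, enumerated such that the indices \<open>i\<close> and \<open>i + L\<close> belong to
  mutually inverse roots.\<close>

definition tau :: "nat \<Rightarrow> nat \<Rightarrow> int" where
  "tau L i = (if i < L then 2 * int i + 1 else - (2 * int (i - L) + 1))"

definition zr :: "nat \<Rightarrow> nat \<Rightarrow> complex" where
  "zr L i = cis (pi * of_int (tau L i) / of_nat (2*L))"

context
  fixes L :: nat
  assumes L: "L > 0"
begin

lemma zr_pow: "zr L i ^ (2*L) = -1"
proof -
  have "zr L i ^ (2*L) = cis (pi * of_int (tau L i))"
    using L unfolding zr_def DeMoivre by simp
  moreover have "odd (tau L i)" by (simp add: tau_def)
  ultimately show ?thesis by (simp add: complex_eq_iff cos_npi_int sin_npi_int)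
qed

lemma zr_nonzero: "zr L i \<noteq> 0"
  by (simp add: zr_def)

lemma zr_not_pm1: "zr L i * zr L i \<noteq> 1"
proof
  assume "zr L i * zr L i = 1"
  then have "zr L i ^ (2*L) = 1" by (simp add: power_mult power2_eq_square)
  then show False by (simp add: zr_pow)
qed

lemma zr_bar: "i < L \<Longrightarrow> zr L (i + L) = 1 / zr L i"
  by (simp add: zr_def tau_def inverse_eq_divide[symmetric] minus_divide_left algebra_simps)

lemma zr_inj:
  assumes "i < 2*L" "k < 2*L" "zr L i = zr L k"
  shows "i = k"
proof -
  let ?x = "pi * of_int (tau L i - tau L k) / of_nat (2*L)"
  have "cis ?x = zr L i / zr L k"
    by (simp add: zr_def cis_divide diff_divide_distrib right_diff_distrib)
  then have "cis ?x = 1" using assms(3) zr_nonzero by simp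
  then have "cos ?x = 1" by (metis cis.sel(1) one_complex.sel(1))
  then obtain n :: int where "?x = of_int n * 2 * pi" using cos_one_2pi_int by blast
  then have "pi * of_int (tau L i - tau L k) = pi * of_int (n * (4 * int L))"
    using L by (simp add: field_simps)
  then have n: "tau L i - tau L k = n * (4 * int L)"
    using mult_left_cancel[OF pi_neq_zero] of_int_eq_iff by blast
  \<comment> \<open>The values of \<open>tau\<close> are odd numbers between \<open>1 - 2*L\<close>
    and \<open>2*L - 1\<close>, so a multiple of \<open>4*L\<close> can be their difference only if
    it is 0.\<close>
  have "\<bar>tau L i - tau L k\<bar> < 4 * int L"
    using assms by (auto simp: tau_def)
  then have "n = 0" unfolding n using L by (simp add: abs_mult)
  then show ?thesis using n assms by (auto simp: tau_def split: if_splits)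
qed

lemma zr_orth1:
  assumes "i < 2*L" "k < 2*L"
  shows "(\<Sum>j=1..2*L. zr L k ^ j / zr L i ^ j) = (if k = i then of_nat (2*L) else 0)"
proof (cases "k = i")
  case True
  then show ?thesis by (simp add: zr_nonzero)
next
  case False
  define r where "r = zr L k / zr L i"
  have r1: "r \<noteq> 1" using False zr_inj[OF assms] zr_nonzero by (auto simp: r_def)
  have "r ^ (2*L) = 1" by (simp add: r_def power_divide zr_pow)
  then have "(\<Sum>j<2*L. r ^ j) = 0" using geometric_sum[OF r1, of "2*L"] by simp
  moreover have "(\<Sum>j=1..2*L. r ^ j) = r * (\<Sum>j<2*L. r ^ j)"
    by (simp add: sum_distrib_left lessThan_atLeast0 sum.atLeast1_atMost_eq)
  ultimately show ?thesis using False by (simp add: r_def power_divide)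
qed

text \<open>Orthogonality in the site index follows from that in the mode index, because a one-sided
  inverse of a square matrix is two-sided. The \<open>Suc\<close> translates the 0-based matrix
  indices into sites.\<close>

lemma zr_orth2:
  assumes "j \<in> {1..2*L}" "l \<in> {1..2*L}"
  shows "(\<Sum>i<2*L. zr L i ^ j / zr L i ^ l) = (if l = j then of_nat (2*L) else 0)"
proof -
  let ?n = "2*L"
  define M where "M = mat ?n ?n (\<lambda>(i, j). 1 / zr L i ^ Suc j)"
  define K where "K = mat ?n ?n (\<lambda>(j, i). zr L i ^ Suc j / of_nat ?n)"
  have "M * K = 1\<^sub>m ?n"
  proof (rule eq_matI)
    fix i k assume ik: "i < dim_row (1\<^sub>m ?n)" "k < dim_col (1\<^sub>m ?n)"
    then have "(M * K) $$ (i, k) = (\<Sum>j<?n. zr L k ^ Suc j / zr L i ^ Suc j / of_nat ?n)"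
      by (simp add: M_def K_def scalar_prod_def lessThan_atLeast0)
    also have "\<dots> = (\<Sum>j=1..?n. zr L k ^ j / zr L i ^ j) / of_nat ?n"
      by (simp only: sum_divide_distrib One_nat_def sum.atLeast1_atMost_eq)
    also have "\<dots> = 1\<^sub>m ?n $$ (i, k)" using ik L by (simp add: zr_orth1[simplified])
    finally show "(M * K) $$ (i, k) = 1\<^sub>m ?n $$ (i, k)" .
  qed (simp_all add: M_def K_def)
  then have KM: "K * M = 1\<^sub>m ?n"
    by (intro mat_mult_left_right_inverse[of M ?n K]) (simp_all add: M_def K_def)
  define j' l' where "j' = j - 1" and "l' = l - 1"
  have jl: "j = Suc j'" "l = Suc l'" "j' < ?n" "l' < ?n" using assms by (auto simp: j'_def l'_def)
  have "(K * M) $$ (j', l') = (\<Sum>i<?n. zr L i ^ j / zr L i ^ l) / of_nat ?n"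
    using jl by (simp add: M_def K_def scalar_prod_def lessThan_atLeast0 sum_divide_distrib mult.commute)
  moreover have "(K * M) $$ (j', l') = (if l = j then 1 else 0)"
    unfolding KM using jl by auto
  ultimately show ?thesis using L by (simp add: field_simps split: if_splits)
qed

end

subsection \<open>The antiperiodic chain\<close>

locale fermion_chain = calg scale
  for scale :: "complex \<Rightarrow> 'a::ring_1 \<Rightarrow> 'a" (infixr "*s" 75) +
  fixes L :: nat and f fd :: "nat \<Rightarrow> 'a"
  assumes L: "L > 0"
    and ff: "j \<in> {1..2*L} \<Longrightarrow> k \<in> {1..2*L} \<Longrightarrow> f j * f k + f k * f j = 0"
    and fdfd: "j \<in> {1..2*L} \<Longrightarrow> k \<in> {1..2*L} \<Longrightarrow> fd j * fd k + fd k * fd j = 0"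
    and ffd: "j \<in> {1..2*L} \<Longrightarrow> k \<in> {1..2*L} \<Longrightarrow> f j * fd k + fd k * f j = (if j = k then (-1) ^ j else 0) *s 1"
begin

definition z :: "nat \<Rightarrow> complex" where
  "z = zr L"

text \<open>Chosen so that \<open>a j\<close> in the \<open>psi i\<close> and \<open>b j\<close> in
  the \<open>chi i\<close> have the same coefficients. This requires
  \<open>2*L * w i * w (bar i) * (z i - 1 / z i) = sg i\<close>; setting \<open>w\<close> to 1 on
  the upper half leaves this value on the lower half.\<close>

definition w :: "nat \<Rightarrow> complex" where
  "w i = (if i < L then 1 / (of_nat (2*L) * (z i - 1 / z i)) else 1)"

text \<open>Passing from \<open>f j\<close> to the sum of neighbours multiplies the mode of momentum
  \<open>z i\<close> by \<open>1 + z i\<close>, so \<open>w i\<close> is the normalisation of the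
  modes of \<open>a\<close>; see \<open>psi_a\<close>.\<close>

definition g :: "nat \<Rightarrow> complex" where
  "g i = w i * (1 + z i)"

definition psi :: "nat \<Rightarrow> 'a" where
  "psi i = (\<Sum>j=1..2*L. (g i / z i ^ j) *s f j)"

text \<open>The sign in \<open>- z i\<close> compensates the alternating sign of the anticommutators
  at site \<open>j\<close>; the denominator makes these modes dual to the
  \<open>psi i\<close>.\<close>

definition psid :: "nat \<Rightarrow> 'a" where
  "psid i = (\<Sum>j=1..2*L. ((- z i) ^ j / (of_nat (2*L) * g i)) *s fd j)"

lemma z0: "z i \<noteq> 0"
  and zpow: "z i ^ (2*L) = -1"
  and zbar: "i < L \<Longrightarrow> z (i + L) = 1 / z i"
  using zr_nonzero[OF L] zr_pow[OF L] zr_bar[OF L] by (simp_all add: z_def)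

lemma z1: "1 + z i \<noteq> 0"
proof
  assume "1 + z i = 0"
  then have "z i = -1" by (simp add: add_eq_0_iff)
  then show False using zr_not_pm1[OF L, of i] by (simp add: z_def)
qed

text \<open>Nondegeneracy of the form: \<open>z i - 1 / z i\<close> is the eigenvalue of
  \<open>omega\<close> (below) on the vector of powers of \<open>z i\<close>. It would vanish at 1
  and -1, which satisfy \<open>z ^ (2*L) = 1\<close>.\<close>

lemma gamma0: "z i - 1 / z i \<noteq> 0"
  using zr_not_pm1[OF L, of i] z0[of i] by (simp add: z_def field_simps)

lemma w0: "w i \<noteq> 0"
  using L gamma0[of i] by (simp add: w_def)

lemma g0: "g i \<noteq> 0"
  using w0 z1 by (simp add: g_def)

lemma psi_anticomm: "psi i * psi k + psi k * psi i = 0"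
  unfolding psi_def by (subst anticommutator_sums[where e = "\<lambda>_ _. 0"]) (simp_all add: ff)

lemma psid_anticomm: "psid i * psid k + psid k * psid i = 0"
  unfolding psid_def by (subst anticommutator_sums[where e = "\<lambda>_ _. 0"]) (simp_all add: fdfd)

lemma psi_psid:
  assumes "i < 2*L" "k < 2*L"
  shows "psi i * psid k + psid k * psi i = (if i = k then 1 else 0)"
proof -
  have reorder: "x / y * (s * u / v) * s = (s * s) * (x / v * (u / y))" for x y s u v :: complex
    by (simp add: mult_ac)
  have "psi i * psid k + psid k * psi i =
    (\<Sum>j=1..2*L. \<Sum>l=1..2*L. g i / z i ^ j * ((- z k) ^ l / (of_nat (2*L) * g k)) * (if j = l then (-1) ^ j else 0)) *s 1"
    unfolding psi_def psid_def by (rule anticommutator_sums) (simp_all add: ffd)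
  also have "(\<Sum>j=1..2*L. \<Sum>l=1..2*L. g i / z i ^ j * ((- z k) ^ l / (of_nat (2*L) * g k)) * (if j = l then (-1) ^ j else 0)) =
    (\<Sum>j=1..2*L. g i / (of_nat (2*L) * g k) * (z k ^ j / z i ^ j))"
  proof (rule sum.cong[OF refl])
    fix j assume j: "j \<in> {1..2*L}"
    have "(\<Sum>l=1..2*L. g i / z i ^ j * ((- z k) ^ l / (of_nat (2*L) * g k)) * (if j = l then (-1) ^ j else 0)) =
      (\<Sum>l=1..2*L. if j = l then g i / z i ^ j * ((- z k) ^ l / (of_nat (2*L) * g k)) * (-1) ^ j else 0)"
      by (intro sum.cong refl) simp
    also have "\<dots> = g i / z i ^ j * ((- z k) ^ j / (of_nat (2*L) * g k)) * (-1) ^ j"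
      using j by simp
    also have "(- z k) ^ j = (-1) ^ j * z k ^ j" by (rule power_minus)
    also have "g i / z i ^ j * ((-1) ^ j * z k ^ j / (of_nat (2*L) * g k)) * (-1) ^ j =
      ((-1) ^ j * (-1) ^ j) * (g i / (of_nat (2*L) * g k) * (z k ^ j / z i ^ j))"
      by (rule reorder)
    also have "(-1) ^ j * (-1) ^ j = (1::complex)" by (simp add: power_mult_distrib[symmetric])
    finally show "(\<Sum>l=1..2*L. g i / z i ^ j * ((- z k) ^ l / (of_nat (2*L) * g k)) * (if j = l then (-1) ^ j else 0)) =
      g i / (of_nat (2*L) * g k) * (z k ^ j / z i ^ j)" by simp
  qed
  also have "\<dots> = g i / (of_nat (2*L) * g k) * (if k = i then of_nat (2*L) else 0)"
    unfolding sum_distrib_left[symmetric] using zr_orth1[OF L assms] by (simp add: z_def)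
  finally show ?thesis using g0[of i] L by (cases "i = k") auto
qed

sublocale car scale L psi psid
proof
  fix i k
  show "psi i * psi k = - (psi k * psi i)" "psid i * psid k = - (psid k * psid i)"
    using psi_anticomm[of i k] psid_anticomm[of i k] by (simp_all add: eq_neg_iff_add_eq_0)
  assume "i < 2*L" "k < 2*L"
  then show "psid i * psi k = (if i = k then 1 else 0) - psi k * psid i"
    using psi_psid[of k i] by (simp add: eq_diff_eq add.commute)
qed

lemma f_psi:
  assumes "j \<in> {1..2*L}"
  shows "f j = (\<Sum>i<2*L. (z i ^ j / (of_nat (2*L) * g i)) *s psi i)"
proof (rule sum_change_basis[OF psi_def assms])
  fix k assume k: "k \<in> {1..2*L}"
  have "(\<Sum>i<2*L. z i ^ j / (of_nat (2*L) * g i) * (g i / z i ^ k)) = (\<Sum>i<2*L. z i ^ j / z i ^ k) / of_nat (2*L)"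
    unfolding sum_divide_distrib using g0 by (intro sum.cong refl) (simp add: field_simps)
  then show "(\<Sum>i<2*L. z i ^ j / (of_nat (2*L) * g i) * (g i / z i ^ k)) = (if k = j then 1 else 0)"
    using zr_orth2[OF L assms k] L by (simp add: z_def)
qed simp

lemma fd_psid:
  assumes "j \<in> {1..2*L}"
  shows "fd j = (\<Sum>i<2*L. (g i / (- z i) ^ j) *s psid i)"
proof (rule sum_change_basis[OF psid_def assms])
  fix k assume k: "k \<in> {1..2*L}"
  have sign: "(- x) ^ k / (- x) ^ j = (-1) ^ k * (-1) ^ j * (x ^ k / x ^ j)" for x :: complex
    unfolding power_minus[of x] by (cases "even j") simp_all
  have "(\<Sum>i<2*L. g i / (- z i) ^ j * ((- z i) ^ k / (of_nat (2*L) * g i))) =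
    (-1) ^ k * (-1) ^ j * (\<Sum>i<2*L. z i ^ k / z i ^ j) / of_nat (2*L)"
    unfolding sum_divide_distrib sum_distrib_left
  proof (intro sum.cong refl)
    fix i
    have "g i / (- z i) ^ j * ((- z i) ^ k / (of_nat (2*L) * g i)) = (- z i) ^ k / (- z i) ^ j / of_nat (2*L)"
      using g0[of i] by simp
    then show "g i / (- z i) ^ j * ((- z i) ^ k / (of_nat (2*L) * g i)) =
      (-1) ^ k * (-1) ^ j * (z i ^ k / z i ^ j) / of_nat (2*L)" unfolding sign .
  qed
  then show "(\<Sum>i<2*L. g i / (- z i) ^ j * ((- z i) ^ k / (of_nat (2*L) * g i))) = (if k = j then 1 else 0)"
    using zr_orth2[OF L k assms] L by (auto simp: z_def power_mult_distrib[symmetric])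
qed simp

abbreviation fx :: "nat \<Rightarrow> 'a" where
  "fx \<equiv> antiper (2*L) f"

abbreviation fdx :: "nat \<Rightarrow> 'a" where
  "fdx \<equiv> antiper (2*L) fd"

text \<open>Beyond site \<open>2*L\<close> the sign of the antiperiodic continuation is reproduced
  by \<open>z i ^ (2*L) = -1\<close>, so one Fourier formula covers the boundary term as
  well.\<close>

lemma fx_psi:
  assumes "1 \<le> j" "j \<le> 4*L"
  shows "fx j = (\<Sum>i<2*L. (z i ^ j / (of_nat (2*L) * g i)) *s psi i)"
proof (cases "j \<le> 2*L")
  case True
  then show ?thesis using assms by (simp add: antiper_def f_psi)
next
  case False
  have "z i ^ j = - (z i ^ (j - 2*L))" for i
    using False zpow[of i] power_add[of "z i" "2*L" "j - 2*L"] by simp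
  moreover have "j - 2*L \<in> {1..2*L}" using False assms by auto
  note f_psi[OF this]
  ultimately show ?thesis using False
    by (simp add: antiper_def sum_negf)
qed

lemma fdx_psid:
  assumes "1 \<le> j" "j \<le> 4*L"
  shows "fdx j = (\<Sum>i<2*L. (g i / (- z i) ^ j) *s psid i)"
proof (cases "j \<le> 2*L")
  case True
  then show ?thesis using assms by (simp add: antiper_def fd_psid)
next
  case False
  have "(- z i) ^ j = - ((- z i) ^ (j - 2*L))" for i
    using False zpow[of i] power_add[of "- z i" "2*L" "j - 2*L"] by simp
  moreover have "j - 2*L \<in> {1..2*L}" using False assms by auto
  note fd_psid[OF this]
  ultimately show ?thesis using False
    by (simp add: antiper_def sum_negf)
qed

section \<open>The sums of neighbours in symplectic modes, and their anticommutators\<close>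

definition a :: "nat \<Rightarrow> 'a" where
  "a j = fx j + fx (j + 1)"

definition b :: "nat \<Rightarrow> 'a" where
  "b j = (-1) ^ j *s (fdx j + fdx (j + 1))"

definition alpha :: "nat \<Rightarrow> nat \<Rightarrow> complex" where
  "alpha j i = z i ^ j / (of_nat (2*L) * w i)"

lemma a_psi:
  assumes "j \<in> {1..2*L}"
  shows "a j = (\<Sum>i<2*L. alpha j i *s psi i)"
proof -
  have eq: "z i ^ j / (of_nat (2*L) * g i) + z i ^ (j + 1) / (of_nat (2*L) * g i) = alpha j i" for i
    using z1[of i] w0[of i] L by (simp add: alpha_def g_def divide_simps) (simp add: algebra_simps)
  have "a j = (\<Sum>i<2*L. (z i ^ j / (of_nat (2*L) * g i) + z i ^ (j + 1) / (of_nat (2*L) * g i)) *s psi i)"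
    using assms L by (simp add: a_def fx_psi scale_left_distrib sum.distrib)
  then show ?thesis unfolding eq .
qed

text \<open>Sharing the coefficients \<open>alpha j\<close> with \<open>a j\<close> is what makes
  \<open>a j * b j\<close> a symmetric, rank-one element of sp. The identity to check for each mode
  is the normalisation condition on \<open>w\<close>.\<close>

lemma b_chi:
  assumes "j \<in> {1..2*L}"
  shows "b j = (\<Sum>i<2*L. alpha j i *s chi i)"
proof -
  have eq: "(-1) ^ j * (g i / (- z i) ^ j + g i / (- z i) ^ (j + 1)) = w i * (z i - 1 / z i) / z i ^ j" for i
  proof -
    have "(-1) ^ j * (g i / (- z i) ^ j + g i / (- z i) ^ (j + 1)) =
      ((-1) ^ j / (- z i) ^ j) * (g i - g i / z i)"
      using z0[of i] by (simp add: divide_simps)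
    also have "(-1) ^ j / (- z i) ^ j = 1 / z i ^ j" by (simp add: power_minus[of "z i"])
    also have "g i - g i / z i = w i * (z i - 1 / z i)"
      using z0[of i] by (simp add: g_def divide_simps) (simp add: algebra_simps)
    finally show ?thesis by simp
  qed
  have "b j = (\<Sum>i<2*L. ((-1) ^ j * (g i / (- z i) ^ j + g i / (- z i) ^ (j + 1))) *s psid i)"
    using assms L
    by (simp add: b_def fdx_psid scale_left_distrib scale_right_distrib sum.distrib scale_sum_right distrib_left del: power_Suc)
  also have "\<dots> = (\<Sum>i<2*L. (- alpha j (bar i) * sg (bar i)) *s psid i)"
    unfolding eq
  proof (intro sum.cong refl)
    fix i assume i: "i \<in> {..<2*L}"
    have "w i * (z i - 1 / z i) / z i ^ j = - alpha j (bar i) * sg (bar i)"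
    proof (cases "i < L")
      case True
      then show ?thesis using gamma0[of i] L
        by (simp add: bar_def sg_def alpha_def w_def zbar power_divide)
    next
      case False
      then obtain l where l: "i = l + L" "l < L" using i by (auto simp: not_less dest: le_imp_diff_is_add)
      then show ?thesis using gamma0[of l] L
        by (simp add: bar_def sg_def alpha_def w_def zbar power_divide divide_simps) (simp add: algebra_simps)
    qed
    then show "(w i * (z i - 1 / z i) / z i ^ j) *s psid i = (- alpha j (bar i) * sg (bar i)) *s psid i" by simp
  qed
  also have "\<dots> = (\<Sum>i<2*L. alpha j i *s chi i)"
    by (subst sum_bar[symmetric], intro sum.cong refl) (simp add: bar_bar chi_def)
  finally show ?thesis .
qed

lemma alpha_inverse:
  assumes "i < 2*L" "k < 2*L"
  shows "(\<Sum>j=1..2*L. w i / z i ^ j * alpha j k) = (if k = i then 1 else 0)"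
proof -
  have "(\<Sum>j=1..2*L. w i / z i ^ j * alpha j k) = w i / (of_nat (2*L) * w k) * (\<Sum>j=1..2*L. z k ^ j / z i ^ j)"
    unfolding sum_distrib_left by (intro sum.cong refl) (simp add: alpha_def)
  then show ?thesis using zr_orth1[OF L assms] w0[of i] L by (simp add: z_def)
qed

lemma psi_a: "i < 2*L \<Longrightarrow> psi i = (\<Sum>j=1..2*L. (w i / z i ^ j) *s a j)"
  by (rule sum_change_basis[OF a_psi _ finite_lessThan alpha_inverse]) auto

lemma chi_b: "i < 2*L \<Longrightarrow> chi i = (\<Sum>j=1..2*L. (w i / z i ^ j) *s b j)"
  by (rule sum_change_basis[OF b_chi _ finite_lessThan alpha_inverse]) auto

text \<open>A cyclic nearest-neighbour matrix whose corner entries have the opposite sign because of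
  the antiperiodic twist. For \<open>L = 1\<close> corner and neighbour entries coincide in position
  and add up to 2 and -2 instead of cancelling, so neighbours pair nontrivially for every
  \<open>L\<close>.\<close>

definition omega :: "nat \<Rightarrow> nat \<Rightarrow> complex" where
  "omega j k = (if k = j + 1 then 1 else 0) - (if j = k + 1 then 1 else 0)
    + (if j = 1 \<and> k = 2*L then 1 else 0) - (if j = 2*L \<and> k = 1 then 1 else 0)"

lemma a_anticomm:
  assumes "j \<in> {1..2*L}" "k \<in> {1..2*L}"
  shows "a j * a k = - (a k * a j)"
proof -
  have "a j * a k + a k * a j = 0"
    unfolding a_psi[OF assms(1)] a_psi[OF assms(2)]
    by (subst anticommutator_sums[where e = "\<lambda>_ _. 0"]) (simp_all add: psi_anticomm)
  then show ?thesis by (simp add: eq_neg_iff_add_eq_0)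
qed

lemma chi_anticomm: "chi i * chi k + chi k * chi i = 0"
proof -
  have "chi i * chi k + chi k * chi i =
      (sg i * sg k) *s (psid (bar i) * psid (bar k) + psid (bar k) * psid (bar i))"
    by (simp add: chi_def scale_mult_left scale_mult_right scale_right_distrib mult.commute)
  then show ?thesis by (simp add: psid_anticomm)
qed

lemma b_anticomm:
  assumes "j \<in> {1..2*L}" "k \<in> {1..2*L}"
  shows "b j * b k = - (b k * b j)"
proof -
  have "b j * b k + b k * b j = 0"
    unfolding b_chi[OF assms(1)] b_chi[OF assms(2)]
    by (subst anticommutator_sums[where e = "\<lambda>_ _. 0"]) (simp_all add: chi_anticomm)
  then show ?thesis by (simp add: eq_neg_iff_add_eq_0)
qed

text \<open>Site \<open>2*L + 1\<close> carries minus the operators of site 1, whose anticommutator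
  is -1. One factor from each of these sites gives +1; two factors from the extra site give -1, in
  accordance with its odd number.\<close>

lemma fx_fdx:
  assumes "1 \<le> j" "j \<le> 2*L + 1" "1 \<le> k" "k \<le> 2*L + 1"
  shows "fx j * fdx k + fdx k * fx j =
    (if j = k then (-1) ^ j else if j = 1 \<and> k = 2*L + 1 \<or> j = 2*L + 1 \<and> k = 1 then 1 else 0) *s 1"
proof -
  consider "j \<le> 2*L" "k \<le> 2*L" | "j \<le> 2*L" "k = 2*L + 1" | "j = 2*L + 1" "k \<le> 2*L" | "j = 2*L + 1" "k = 2*L + 1"
    using assms by linarith
  then show ?thesis
  proof cases
    case 1
    then show ?thesis using assms ffd[of j k] by (simp add: antiper_def)
  next
    case 2
    then have "f j * fd 1 = (if j = 1 then -1 else 0) - fd 1 * f j"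
      using assms L ffd[of j 1] by (simp add: eq_diff_eq)
    then show ?thesis using 2 assms L by (simp add: antiper_def)
  next
    case 3
    then have "f 1 * fd k = (if k = 1 then -1 else 0) - fd k * f 1"
      using assms L ffd[of 1 k] by (simp add: eq_diff_eq)
    then show ?thesis using 3 assms L by (simp add: antiper_def)
  next
    case 4
    then show ?thesis using assms L ffd[of 1 1] by (simp add: antiper_def)
  qed
qed

lemma b_a_anticomm:
  assumes "j \<in> {1..2*L}" "k \<in> {1..2*L}"
  shows "b j * a k = omega k j *s 1 - a k * b j"
proof -
  have jk: "1 \<le> j" "j \<le> 2*L" "1 \<le> k" "k \<le> 2*L" using assms by auto
  have expand: "(x + y) * (c *s (u + v)) + (c *s (u + v)) * (x + y) =
    c *s ((x * u + u * x) + (y * v + v * y) + (x * v + v * x) + (y * u + u * y))" for x y u v c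
    by (simp add: scale_mult_left scale_mult_right distrib_left distrib_right scale_right_distrib)
  \<comment> \<open>The contributions of sites \<open>j\<close> and \<open>j + 1\<close> to the
    diagonal have opposite signs and cancel; only neighbouring indices keep a nonzero
    anticommutator.\<close>
  have same: "fx k * fdx j + fdx j * fx k = (if k = j then (-1) ^ j else 0) *s 1"
    using jk fx_fdx[of k j] by auto
  have same': "fx (k+1) * fdx (j+1) + fdx (j+1) * fx (k+1) = (if k = j then - ((-1) ^ j) else 0) *s 1"
    using jk fx_fdx[of "k+1" "j+1"] by auto
  have up: "fx k * fdx (j+1) + fdx (j+1) * fx k =
      (if k = j + 1 then - ((-1) ^ j) else if k = 1 \<and> j = 2*L then 1 else 0) *s 1"
    using jk fx_fdx[of k "j+1"] by auto
  have down: "fx (k+1) * fdx j + fdx j * fx (k+1) =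
      (if j = k + 1 then (-1) ^ j else if k = 2*L \<and> j = 1 then 1 else 0) *s 1"
    using jk fx_fdx[of "k+1" j] by auto
  have sq: "(-1) ^ j * (-1) ^ j = (1::complex)" by (simp add: power_mult_distrib[symmetric])
  have scalar: "(-1) ^ j * ((if k = j + 1 then - ((-1) ^ j) else if k = 1 \<and> j = 2*L then 1 else 0) +
      (if j = k + 1 then (-1) ^ j else if k = 2*L \<and> j = 1 then 1 else 0)) = omega k j"
    using jk sq by (auto simp: omega_def)
  have "a k * b j + b j * a k = omega k j *s 1"
    unfolding a_def b_def expand same same' up down scale_left_distrib[symmetric] scale_scale
    unfolding scalar[symmetric] by (rule arg_cong[of _ _ "\<lambda>c. c *s 1"]) simp
  then show ?thesis by (simp add: eq_diff_eq add.commute)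
qed

lemma a_b_quad:
  assumes "j \<in> {1..2*L}"
  shows "a j * b j = quad (\<lambda>i k. alpha j i * alpha j k)"
  unfolding quad_outer a_psi[OF assms] b_chi[OF assms] ..

lemma sp_elt_in_subalg:
  assumes A: "subalg A" and e: "\<And>j. j \<in> {1..2*L} \<Longrightarrow> a j * b j \<in> A" and ik: "i < 2*L" "k < 2*L"
  shows "sp_elt i k \<in> A"
proof -
  have "psi i * chi k = (\<Sum>j=1..2*L. \<Sum>l=1..2*L. (w i / z i ^ j * (w k / z k ^ l)) *s (a j * b l))"
    unfolding psi_a[OF ik(1)] chi_b[OF ik(2)] by (rule mult_sum_scale)
  moreover have "psi k * chi i = (\<Sum>j=1..2*L. \<Sum>l=1..2*L. (w i / z i ^ j * (w k / z k ^ l)) *s (a l * b j))"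
    unfolding psi_a[OF ik(2)] chi_b[OF ik(1)] mult_sum_scale by (subst sum.swap) (simp add: mult.commute)
  ultimately have "sp_elt i k = (\<Sum>j=1..2*L. \<Sum>l=1..2*L. (w i / z i ^ j * (w k / z k ^ l)) *s (a j * b l + a l * b j))"
    by (simp add: sp_elt_def scale_right_distrib sum.distrib)
  moreover have "a j * b l + a l * b j \<in> A" if "j \<in> {1..2*L}" "l \<in> {1..2*L}" for j l
    using A a_anticomm b_anticomm b_a_anticomm _ _ e that
    by (rule sym_products_in_subalg[where N = "2*L" and \<omega> = omega]) (auto simp: omega_def)
  ultimately show ?thesis using A by (auto intro!: subalg_sum subalg_scale)
qed

lemma rho_in_subalg:
  assumes A: "subalg A" and e: "\<And>j. j \<in> {1..2*L} \<Longrightarrow> a j * b j \<in> A" and X: "X \<in> sp_alg L"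
  shows "rho X \<in> A"
proof -
  have "rho X = (1/2) *s (\<Sum>i<2*L. \<Sum>k<2*L. (- sg k * X $$ (i, bar k)) *s sp_elt i k)"
    unfolding rho_quad(1)[OF X] by (rule quad_sym) (rule rho_quad(2)[OF X])
  then show ?thesis using sp_elt_in_subalg[OF A e] A by (auto intro!: subalg_sum subalg_scale simp del: mult_minus_left)
qed

section \<open>The translation as a torus element\<close>

lemma translation_conjugates:
  assumes inv: "U * U' = 1" "U' * U = 1"
    and U: "\<And>j. j \<in> {1..2*L} \<Longrightarrow> U * f j * U' = fx (j + 2)" "\<And>j. j \<in> {1..2*L} \<Longrightarrow> U * fd j * U' = fdx (j + 2)"
  shows "conjugates U U' (\<lambda>i. z i ^ 2)"
proof -
  have lin: "U * (\<Sum>j=1..2*L. s j *s x j) * U' = (\<Sum>j=1..2*L. s j *s (U * x j * U'))" for s x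
    by (simp add: sum_distrib_left sum_distrib_right scale_mult_left scale_mult_right)
  have L2: "2 \<le> 2*L" using L by simp
  have psi: "U * psi i * U' = z i ^ 2 *s psi i" for i
  proof -
    have "U * psi i * U' = g i *s (\<Sum>j=1..2*L. (1 / z i ^ j) *s fx (j + 2))"
      unfolding psi_def lin scale_sum_right by (intro sum.cong refl) (simp add: U)
    also have "\<dots> = z i ^ 2 *s psi i"
      unfolding antiper_fourier[OF L2 zpow] psi_def scale_sum_right by (simp add: mult_ac)
    finally show ?thesis .
  qed
  have psid: "U * psid i * U' = (1 / z i ^ 2) *s psid i" for i
  proof -
    \<comment> \<open>This root turns the weights \<open>(- z i) ^ j\<close> of \<open>psid\<close>
      into \<open>1 / \<zeta> ^ j\<close>, the form treated by \<open>antiper_fourier\<close>. Its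
      square is the inverse of \<open>z i ^ 2\<close>, as it must be for dual modes.\<close>
    define \<zeta> where "\<zeta> = - 1 / z i"
    have \<zeta>: "\<zeta> ^ (2*L) = -1" using zpow[of i] by (simp add: \<zeta>_def power_divide)
    have "- z i = 1 / \<zeta>" using z0[of i] by (simp add: \<zeta>_def)
    then have pow: "(- z i) ^ j = 1 / \<zeta> ^ j" for j by (simp only: power_one_over)
    have psid_eq: "psid i = (1 / (of_nat (2*L) * g i)) *s (\<Sum>j=1..2*L. (1 / \<zeta> ^ j) *s fd j)"
      unfolding psid_def scale_sum_right pow by (simp add: mult_ac)
    have "U * psid i * U' = (1 / (of_nat (2*L) * g i)) *s (\<Sum>j=1..2*L. (1 / \<zeta> ^ j) *s fdx (j + 2))"
      unfolding psid_def lin scale_sum_right pow by (intro sum.cong refl) (simp add: U)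
    also have "\<dots> = \<zeta> ^ 2 *s psid i"
      unfolding antiper_fourier[OF L2 \<zeta>] psid_eq by (simp only: scale_scale mult.commute)
    also have "\<zeta> ^ 2 = 1 / z i ^ 2" by (simp add: \<zeta>_def power_divide)
    finally show ?thesis .
  qed
  have "U * psi i = z i ^ 2 *s (psi i * U)" for i
  proof -
    have "U * psi i = U * psi i * U' * U" by (simp add: mult.assoc inv)
    then show ?thesis by (simp add: psi scale_mult_left)
  qed
  moreover have "psid i * U = z i ^ 2 *s (U * psid i)" for i
  proof -
    have "U * psid i = U * psid i * U' * U" by (simp add: mult.assoc inv)
    then show ?thesis using z0[of i] by (simp add: psid scale_mult_left)
  qed
  ultimately show ?thesis using inv by (simp add: conjugates_def)
qed

lemma conjugates_inverse:
  assumes D: "conjugates D D' \<mu>" and \<mu>: "\<And>i. i < 2*L \<Longrightarrow> \<mu> i \<noteq> 0"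
  shows "conjugates D' D (\<lambda>i. 1 / \<mu> i)"
proof -
  have inv: "D * D' = 1" "D' * D = 1" using D by (auto simp: conjugates_def)
  have "D' * psi i = (1 / \<mu> i) *s (psi i * D')" if i: "i < 2*L" for i
  proof -
    have "psi i * D' = D' * (D * psi i) * D'" by (simp add: mult.assoc[symmetric] inv)
    also have "\<dots> = D' * (\<mu> i *s (psi i * D)) * D'" using D i by (simp add: conjugates_def)
    also have "\<dots> = \<mu> i *s (D' * psi i * (D * D'))"
      by (simp only: scale_mult_left scale_mult_right mult.assoc)
    finally show ?thesis using \<mu>[OF i] inv by simp
  qed
  moreover have "psid i * D' = (1 / \<mu> i) *s (D' * psid i)" if i: "i < 2*L" for i
  proof -
    have "D' * psid i = D' * (psid i * D) * D'" by (simp add: mult.assoc inv)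
    also have "\<dots> = D' * (\<mu> i *s (D * psid i)) * D'" using D i by (simp add: conjugates_def)
    also have "\<dots> = \<mu> i *s (D' * D * psid i * D')"
      by (simp only: scale_mult_left scale_mult_right mult.assoc)
    finally show ?thesis using \<mu>[OF i] inv by simp
  qed
  ultimately show ?thesis using inv by (simp add: conjugates_def)
qed

lemma conjugates_one_commute:
  assumes D: "conjugates D D' (\<lambda>i. 1)" and j: "j \<in> {1..2*L}"
  shows "D * f j = f j * D" "D * fd j = fd j * D"
proof -
  show "D * f j = f j * D"
    unfolding f_psi[OF j] sum_distrib_left sum_distrib_right
    using D by (intro sum.cong refl) (simp add: conjugates_def scale_mult_left scale_mult_right)
  show "D * fd j = fd j * D"
    unfolding fd_psid[OF j] sum_distrib_left sum_distrib_right
    using D by (intro sum.cong refl) (simp add: conjugates_def scale_mult_left scale_mult_right)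
qed

text \<open>The eigenvalues \<open>z i ^ 2\<close> at \<open>i\<close> and \<open>i + L\<close> are
  reciprocal, so the torus in \<open>A\<close> contains some \<open>D\<close> with the same
  conjugation action as \<open>U\<close>. Both \<open>U * D'\<close> and \<open>D * U'\<close> then
  commute with all fermions. The set \<open>B\<close> stands for the embedded matrices: in the
  larger ring, commuting with the fermions need not force an element to be scalar, so
  \<open>schur\<close> is relative to \<open>B\<close>.\<close>

lemma translation_in_subalg:
  assumes A: "subalg A" and rho: "\<And>X. X \<in> sp_alg L \<Longrightarrow> rho X \<in> A" and U: "conjugates U U' (\<lambda>i. z i ^ 2)"
    and schur: "\<And>x. x \<in> B \<Longrightarrow> (\<And>j. j \<in> {1..2*L} \<Longrightarrow> x * f j = f j * x \<and> x * fd j = fd j * x) \<Longrightarrow> \<exists>c. x = c *s 1"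
    and B: "subalg B" "A \<subseteq> B" "U \<in> B" "U' \<in> B"
  shows "U \<in> A" "U' \<in> A"
proof -
  have "h l \<in> A" if "l < L" for l
    using that sp_elt_in_rho[of l "l + L"] rho by (auto simp: h_eq_sp_elt)
  then obtain D D' where D: "D \<in> A" "D' \<in> A" "conjugates D D' (\<lambda>i. z i ^ 2)"
    using torus_in_subalg[OF A, of "\<lambda>i. z i ^ 2"] z0 by (auto simp: zbar power_divide)
  have "conjugates (U * D') (D * U') (\<lambda>i. z i ^ 2 * (1 / z i ^ 2))"
    using U conjugates_inverse[OF D(3)] z0 by (intro conjugates_mult) auto
  then have 1: "conjugates (U * D') (D * U') (\<lambda>i. 1)" using z0 by simp
  have 2: "conjugates (D * U') (U * D') (\<lambda>i. 1)" using conjugates_inverse[OF 1] by simp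
  have mem: "U * D' \<in> B" "D * U' \<in> B" using B D by (auto intro: subalg_mult)
  have "\<exists>c. U * D' = c *s 1" "\<exists>c. D * U' = c *s 1"
    by (rule schur[OF mem(1)], use conjugates_one_commute[OF 1] in blast,
        rule schur[OF mem(2)], use conjugates_one_commute[OF 2] in blast)
  then obtain c c' where c: "U * D' = c *s 1" and c': "D * U' = c' *s 1" by blast
  have "U = U * (D' * D)" using D(3) by (simp add: conjugates_def)
  also have "\<dots> = c *s D" using c by (simp add: mult.assoc[symmetric] scale_mult_left)
  finally show "U \<in> A" using subalg_scale[OF A D(1)] by simp
  have "U' = D' * D * U'" using D(3) by (simp add: conjugates_def)
  also have "\<dots> = c' *s D'" using c' by (simp add: mult.assoc scale_mult_right)
  finally show "U' \<in> A" using subalg_scale[OF A D(2)] by simp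
qed

end

theorem theorem4p1:
  fixes L :: nat and f fd :: "nat \<Rightarrow> complex mat" and u2 u2i :: "complex mat"
  assumes "L \<ge> 1"
    and "fermions L f fd"
    and "translation2 L f fd u2 u2i"
  shows "\<exists>n \<rho>. sp_rep L n \<rho> \<and> one_column_rep L n \<rho> \<and>
           alg_iso (dimH L) n (jtl_image L f fd u2 u2i) (Usp_image L n \<rho>)"
proof -
  define n where "n = dimH L"
  have n: "n > 0" by (simp add: n_def dimH_def)
  let ?C = "carrier_mat n n :: complex mat set"
  have fC: "f j \<in> ?C" "fd j \<in> ?C" if "j \<in> {1..2*L}" for j
    using assms(2) that by (simp_all add: fermions_def n_def)
  have anti: "anticomm (f i) (f j) = 0\<^sub>m n n" "anticomm (fd i) (fd j) = 0\<^sub>m n n"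
    "anticomm (f i) (fd j) = (if i = j then (-1) ^ i else 0) \<cdot>\<^sub>m 1\<^sub>m n"
    if "i \<in> {1..2*L}" "j \<in> {1..2*L}" for i j
    using assms(2) that unfolding fermions_def n_def by blast+
  have full: "gen_alg n (f ` {1..2*L} \<union> fd ` {1..2*L}) = ?C"
    using assms(2) by (simp add: fermions_def n_def)
  have uC: "u2 \<in> ?C" "u2i \<in> ?C" and uinv: "u2 * u2i = 1\<^sub>m n" "u2i * u2 = 1\<^sub>m n"
    using assms(3) by (simp_all add: translation2_def n_def)
  have uf: "u2 * f j * u2i = (if j + 2 \<le> 2*L then f (j+2) else - f (j + 2 - 2*L))"
    "u2 * fd j * u2i = (if j + 2 \<le> 2*L then fd (j+2) else - fd (j + 2 - 2*L))"
    if "j \<in> {1..2*L}" for j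
    using assms(3) that unfolding translation2_def by blast+
  have emb_anti: "emb n (anticomm A B) = emb n A * emb n B + emb n B * emb n A"
    if "A \<in> ?C" "B \<in> ?C" for A B
    using that n by (simp add: anticomm_def emb_add emb_mult)
  interpret FC: fermion_chain cendo_scale L "\<lambda>j. emb n (f j)" "\<lambda>j. emb n (fd j)"
  proof
    show "0 < L" using assms(1) by simp
    fix j k assume jk: "j \<in> {1..2*L}" "k \<in> {1..2*L}"
    show "emb n (f j) * emb n (f k) + emb n (f k) * emb n (f j) = 0"
      "emb n (fd j) * emb n (fd k) + emb n (fd k) * emb n (fd j) = 0"
      "emb n (f j) * emb n (fd k) + emb n (fd k) * emb n (f j) = cendo_scale (if j = k then (-1) ^ j else 0) 1"
      using jk n by (simp_all add: emb_anti[symmetric] fC anti emb_zero emb_scale emb_one)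
  qed
  have subB: "cendo.subalg (emb n ` ?C)" using subalg_emb_carrier[OF n] .
  have rhoB: "FC.rho X \<in> emb n ` ?C" for X
    unfolding FC.rho_def FC.bil_def FC.psi_def FC.psid_def using fC subB
    by (auto intro!: cendo.subalg_sum cendo.subalg_scale cendo.subalg_mult)
  \<comment> \<open>By \<open>rhoB\<close> the values of \<open>FC.rho\<close> are embedded
    matrices, so they can be pulled back along the injective \<open>emb n\<close>.\<close>
  define \<rho> where "\<rho> X = inv_into ?C (emb n) (FC.rho X)" for X
  have \<rho>C: "\<rho> X \<in> ?C" and emb_\<rho>: "emb n (\<rho> X) = FC.rho X" for X
    using inv_into_into[OF rhoB] f_inv_into_f[OF rhoB] by (simp_all add: \<rho>_def)

  have rep: "sp_rep L n \<rho>"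
    unfolding sp_rep_def
  proof (intro conjI ballI allI)
    fix X Y a b assume X: "X \<in> sp_alg L" and Y: "Y \<in> sp_alg L"
    show "\<rho> (a \<cdot>\<^sub>m X + b \<cdot>\<^sub>m Y) = a \<cdot>\<^sub>m \<rho> X + b \<cdot>\<^sub>m \<rho> Y"
      using \<rho>C FC.rho_lin[OF X Y]
      by (intro emb_inj[OF n]) (simp_all add: emb_\<rho> emb_add[OF n] emb_scale[OF n])
    show "\<rho> (lie_bracket X Y) = lie_bracket (\<rho> X) (\<rho> Y)"
    proof (rule emb_inj[OF n])
      have prod: "\<rho> X * \<rho> Y \<in> ?C" "\<rho> Y * \<rho> X \<in> ?C"
        using \<rho>C by (auto intro: mult_carrier_mat)
      then show "lie_bracket (\<rho> X) (\<rho> Y) \<in> ?C"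
        by (simp add: lie_bracket_def minus_carrier_mat)
      show "emb n (\<rho> (lie_bracket X Y)) = emb n (lie_bracket (\<rho> X) (\<rho> Y))"
        using FC.rho_bracket[OF X Y] prod \<rho>C
        by (simp add: lie_bracket_def[of "\<rho> X"] emb_\<rho> emb_diff[OF n] emb_mult[OF n])
    qed (rule \<rho>C)
  qed (rule \<rho>C)

  have one_column: "one_column_rep L n \<rho>"
    unfolding one_column_rep_def
  proof (intro allI impI)
    fix W assume simple: "simple_sub L n \<rho> W"
    then have W: "W \<subseteq> carrier_vec n" "0\<^sub>v n \<in> W" "\<And>v w. v \<in> W \<Longrightarrow> w \<in> W \<Longrightarrow> v + w \<in> W"
      "\<And>v c. v \<in> W \<Longrightarrow> c \<cdot>\<^sub>v v \<in> W" "\<And>X w. X \<in> sp_alg L \<Longrightarrow> w \<in> W \<Longrightarrow> \<rho> X *\<^sub>v w \<in> W"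
      "W \<noteq> {0\<^sub>v n}"
      by (auto simp: simple_sub_def invariant_sub_def lin_subspace_def)
    have W': "FC.spmod (vemb n ` W)"
      unfolding FC.spmod_def
    proof (intro conjI ballI allI impI)
      show "0 \<in> vemb n ` W" using W(2) vemb_zero[OF n] by (metis imageI)
      fix x assume "x \<in> vemb n ` W"
      then obtain v where v: "v \<in> W" "v \<in> carrier_vec n" "x = vemb n v" using W(1) by blast
      show "cendo_scale c x \<in> vemb n ` W" for c
        using v W(4) vemb_scale[OF n v(2), of c] by (metis imageI)
      show "FC.sp_elt i k * x \<in> vemb n ` W" if "i < 2*L" "k < 2*L" for i k
      proof -
        have "FC.sp_elt i k \<in> FC.rho ` sp_alg L" using that by (rule FC.sp_elt_in_rho)
        then obtain X where "X \<in> sp_alg L" "FC.sp_elt i k = emb n (\<rho> X)"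
          by (auto simp: emb_\<rho>)
        then show ?thesis using v W(5) vemb_mult[OF n \<rho>C v(2), of X] by (metis imageI)
      qed
      fix y assume "y \<in> vemb n ` W"
      then obtain w where w: "w \<in> W" "w \<in> carrier_vec n" "y = vemb n w" using W(1) by blast
      show "x + y \<in> vemb n ` W" using v w W(3) vemb_add[OF n v(2) w(2)] by (metis imageI)
    qed
    obtain w where "w \<in> W" "w \<noteq> 0\<^sub>v n" using W(2,6) by blast
    then have w': "vemb n w \<in> vemb n ` W" "vemb n w \<noteq> 0"
      using W(1) vemb_inj[OF n, of w "0\<^sub>v n"] vemb_zero[OF n] by auto
    from FC.highest_weight[OF W' w'] obtain v' k where v': "v' \<in> vemb n ` W" "v' \<noteq> 0" and k: "k \<le> L"
      and all: "\<forall>l<L. FC.h l * v' = cendo_scale (if l < k then 1 else 0) v'"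
        "\<forall>i<2*L. \<forall>j<2*L. FC.cost i + FC.cost j > 0 \<longrightarrow> FC.sp_elt i j * v' = 0"
      by blast
    have hv: "FC.h l * v' = cendo_scale (if l < k then 1 else 0) v'" if "l < L" for l
      using all(1) that by blast
    have kill: "FC.sp_elt i j * v' = 0" if "i < 2*L" "j < 2*L" "FC.cost i + FC.cost j > 0" for i j
      using all(2) that by blast
    obtain v where v: "v \<in> W" "v \<in> carrier_vec n" "v' = vemb n v" using v'(1) W(1) by blast
    have "has_hw_omega L n \<rho> W k"
      unfolding has_hw_omega_def
    proof (intro bexI[of _ v] conjI ballI)
      show "v \<noteq> 0\<^sub>v n" using v' v vemb_zero[OF n] by auto
      show "\<rho> X *\<^sub>v v = 0\<^sub>v n" if X: "X \<in> sp_nplus L" for X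
      proof (rule vemb_inj[OF n mult_mat_vec_carrier[OF \<rho>C v(2)] zero_carrier_vec])
        have "FC.rho X * v' = 0" by (rule FC.rho_nplus_kill[OF X]) (rule kill)
        then show "vemb n (\<rho> X *\<^sub>v v) = vemb n (0\<^sub>v n)"
          by (simp only: vemb_mult[OF n \<rho>C v(2)] emb_\<rho> v(3) vemb_zero[OF n])
      qed
      show "\<rho> H *\<^sub>v v = (\<Sum>i<k. H $$ (i, i)) \<cdot>\<^sub>v v" if H: "H \<in> sp_cartan L" for H
      proof (rule vemb_inj[OF n mult_mat_vec_carrier[OF \<rho>C v(2)] smult_carrier_vec[THEN iffD2, OF v(2)]])
        have "FC.rho H * v' = cendo_scale (\<Sum>i<k. H $$ (i, i)) v'"
          by (rule FC.rho_cartan_highest[OF H k]) (rule hv)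
        then show "vemb n (\<rho> H *\<^sub>v v) = vemb n ((\<Sum>i<k. H $$ (i, i)) \<cdot>\<^sub>v v)"
          by (simp only: vemb_mult[OF n \<rho>C v(2)] emb_\<rho> v(3) vemb_scale[OF n v(2)])
      qed
    qed (rule v(1))
    with k show "\<exists>k\<le>L. has_hw_omega L n \<rho> W k" by blast
  qed

  let ?S = "jtl_e L f fd ` {1..2*L} \<union> {u2, u2i}" and ?T = "\<rho> ` sp_alg L"
  have eC: "jtl_e L f fd j \<in> ?C" if "j \<in> {1..2*L}" for j
    using that assms(1) by (auto simp: jtl_e_def intro!: mult_carrier_mat[of _ n n] add_carrier_mat minus_carrier_mat fC)
  have SC: "?S \<subseteq> ?C" using eC uC by auto
  have TC: "?T \<subseteq> ?C" using \<rho>C by auto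
  \<comment> \<open>The scalar \<open>(-1) ^ j\<close> undoes the sign built into
    \<open>FC.b\<close>; at the last site the antiperiodic continuation turns the sums into the
    differences that define \<open>e\<close> there.\<close>
  have emb_e: "emb n (jtl_e L f fd j) = cendo_scale ((-1) ^ j) (FC.a j * FC.b j)" if j: "j \<in> {1..2*L}" for j
  proof -
    have "(-1) ^ j * (-1) ^ j = (1::complex)" by (simp add: power_mult_distrib[symmetric])
    then have "cendo_scale ((-1) ^ j) (FC.a j * FC.b j) = FC.a j * (FC.fdx j + FC.fdx (j + 1))"
      by (simp add: FC.b_def cendo.scale_mult_right)
    also have "\<dots> = emb n (jtl_e L f fd j)"
    proof (cases "j < 2*L")
      case True
      then have "Suc j \<in> {1..2*L}" by auto
      with True j show ?thesis
        by (simp add: FC.a_def cendo.antiper_def jtl_e_def emb_mult[OF n] emb_add[OF n] fC)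
    next
      case False
      then have "j = 2*L" "1 \<in> {1..2*L}" "2*L \<in> {1..2*L}" using j assms(1) by auto
      then show ?thesis
        using fC[of 1] fC[of "2*L"]
        by (simp add: FC.a_def cendo.antiper_def jtl_e_def emb_mult[OF n] emb_diff[OF n] minus_carrier_mat)
    qed
    finally show ?thesis by simp
  qed

  have "?T \<subseteq> gen_alg n ?S"
  proof
    fix M assume "M \<in> ?T"
    then obtain X where X: "X \<in> sp_alg L" "M = \<rho> X" by blast
    have subS: "cendo.subalg (emb n ` gen_alg n ?S)" using subalg_emb_gen_alg[OF n SC] .
    have "FC.a j * FC.b j \<in> emb n ` gen_alg n ?S" if j: "j \<in> {1..2*L}" for j
    proof -
      have "jtl_e L f fd j \<in> gen_alg n ?S" using j by (intro gen_alg.gen) blast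
      then have "cendo_scale ((-1) ^ j) (FC.a j * FC.b j) \<in> emb n ` gen_alg n ?S"
        unfolding emb_e[OF j, symmetric] by (rule imageI)
      then show ?thesis by (rule cendo.scale_cancel_subalg[OF subS]) simp
    qed
    then have "emb n (\<rho> X) \<in> emb n ` gen_alg n ?S"
      unfolding emb_\<rho> using FC.rho_in_subalg[OF subS] X by blast
    then show "M \<in> gen_alg n ?S"
      unfolding X(2) by (rule emb_memD[OF n gen_alg_carrier[OF SC] \<rho>C])
  qed
  moreover have "?S \<subseteq> gen_alg n ?T"
  proof -
    have subT: "cendo.subalg (emb n ` gen_alg n ?T)" using subalg_emb_gen_alg[OF n TC] .
    have rhoT: "FC.rho X \<in> emb n ` gen_alg n ?T" if "X \<in> sp_alg L" for X
      using that unfolding emb_\<rho>[symmetric] by (intro imageI gen_alg.gen) blast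
    have "emb n (jtl_e L f fd j) \<in> emb n ` gen_alg n ?T" if j: "j \<in> {1..2*L}" for j
    proof -
      have "FC.a j * FC.b j \<in> FC.rho ` sp_alg L"
        unfolding FC.a_b_quad[OF j] by (rule FC.quad_in_rho) simp
      then show ?thesis unfolding emb_e[OF j] using rhoT by (auto intro: cendo.subalg_scale[OF subT])
    qed
    then have "jtl_e L f fd j \<in> gen_alg n ?T" if "j \<in> {1..2*L}" for j
      using that emb_memD[OF n gen_alg_carrier[OF TC] eC] by blast
    moreover
    have conj: "FC.conjugates (emb n u2) (emb n u2i) (\<lambda>i. FC.z i ^ 2)"
    proof (rule FC.translation_conjugates)
      show "emb n u2 * emb n u2i = 1" "emb n u2i * emb n u2 = 1"
        using uC uinv by (simp_all add: emb_mult[OF n, symmetric] emb_one[OF n])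
      fix j assume j: "j \<in> {1..2*L}"
      \<comment> \<open>Two steps leave the chain at most once. For \<open>L = 1\<close> every site
        wraps, and returns to itself with a sign.\<close>
      have j2: "j + 2 \<in> {1..2*L} \<or> \<not> j + 2 \<le> 2*L \<and> j + 2 - 2*L \<in> {1..2*L}"
        using j assms(1) unfolding atLeastAtMost_iff by arith
      have conj_emb: "emb n u2 * emb n x * emb n u2i = emb n (u2 * x * u2i)" if "x \<in> ?C" for x
        using emb_mult[OF n mult_carrier_mat[OF uC(1) that] uC(2)] emb_mult[OF n uC(1) that] by simp
      show "emb n u2 * emb n (f j) * emb n u2i = FC.fx (j + 2)"
        "emb n u2 * emb n (fd j) * emb n u2i = FC.fdx (j + 2)"
        unfolding conj_emb[OF fC(1)[OF j]] conj_emb[OF fC(2)[OF j]] uf[OF j] cendo.antiper_def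
        using j2 fC[of "j + 2 - 2*L"] by (auto simp: emb_uminus[OF n])
    qed
    have schur: "\<exists>c. x = cendo_scale c 1"
      if x: "x \<in> emb n ` ?C" and comm: "\<And>j. j \<in> {1..2*L} \<Longrightarrow>
        x * emb n (f j) = emb n (f j) * x \<and> x * emb n (fd j) = emb n (fd j) * x" for x
    proof -
      obtain M where M: "M \<in> ?C" "x = emb n M" using x by blast
      have gens: "M * s = s * M" if "s \<in> f ` {1..2*L} \<union> fd ` {1..2*L}" for s
      proof -
        have "s \<in> ?C" "x * emb n s = emb n s * x" using that fC comm by auto
        then show ?thesis using M
          by (intro emb_inj[OF n]) (auto simp: emb_mult[OF n] intro!: mult_carrier_mat[of _ n n])
      qed
      have gensC: "f ` {1..2*L} \<union> fd ` {1..2*L} \<subseteq> ?C" using fC by auto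
      have "M * X = X * M" if "X \<in> ?C" for X
      proof (rule commutant_gen_alg[OF gensC M(1) gens])
        show "X \<in> gen_alg n (f ` {1..2*L} \<union> fd ` {1..2*L})" unfolding full by (rule that)
      qed
      from central_mat_scalar[OF n M(1) this] obtain c where "M = c \<cdot>\<^sub>m 1\<^sub>m n" by blast
      then show ?thesis using M(2) by (auto simp: emb_scale[OF n] emb_one[OF n])
    qed
    have CB: "emb n ` gen_alg n ?T \<subseteq> emb n ` ?C" by (rule image_mono[OF gen_alg_carrier[OF TC]])
    have mem: "emb n u2 \<in> emb n ` gen_alg n ?T" "emb n u2i \<in> emb n ` gen_alg n ?T"
      by (rule FC.translation_in_subalg[OF subT _ conj _ subB CB imageI[OF uC(1)] imageI[OF uC(2)]];
          (erule rhoT | rule schur); assumption?; blast)+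
    have "u2 \<in> gen_alg n ?T" "u2i \<in> gen_alg n ?T"
      by (rule emb_memD[OF n gen_alg_carrier[OF TC] uC(1) mem(1)],
          rule emb_memD[OF n gen_alg_carrier[OF TC] uC(2) mem(2)])
    ultimately show ?thesis by blast
  qed
  ultimately have "gen_alg n ?S = gen_alg n ?T"
    using gen_alg_least by blast
  then have "jtl_image L f fd u2 u2i = Usp_image L n \<rho>"
    by (simp add: jtl_image_def Usp_image_def n_def)
  \<comment> \<open>Both algebras are the same set of matrices of the same size, so the identity
    serves as isomorphism.\<close>
  then have "alg_iso (dimH L) n (jtl_image L f fd u2 u2i) (Usp_image L n \<rho>)"
    unfolding alg_iso_def n_def by (intro exI[of _ "\<lambda>x. x"]) (auto simp: bij_betw_def)
  with rep one_column show ?thesis by blast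
qed

end
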